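(* For every $(a;b)\in U^{o}$ there exists an integer $M(a;b)\in\mathbb Z$ such that $$bQ(a;b)=\frac{a(1-3b)}{2}+M(a;b).$$ In particular, $bQ(a;b)\in\frac12+\mathbb Z$ if $a$ is odd and $b$ is even, and $bQ(a;b)\in\mathbb Z$ if $a$ is even and $b$ is odd.
   Context: Let $\mathfrak H$ be the upper half plane. For $\tau\in\mathfrak H$ let $q=e^{2\pi\sqrt{-1}\tau}$ and, with fractional powers $q^{r}=e^{2\pi\sqrt{-1}r\tau}$, let $\theta_1(z,\tau)=2\sum_{n\ge 0}(-1)^n q^{\frac12(n+\frac12)^2}\sin((2n+1)\pi z)$, $\theta_2(z,\tau)=2\sum_{n\ge 0} q^{\frac12(n+\frac12)^2}\cos((2n+1)\pi z)$, $\theta_3(z,\tau)=1+2\sum_{n\ge1}q^{\frac12 n^2}\cos(2n\pi z)$, $\theta_4(z,\tau)=1+2\sum_{n\ge1}(-1)^nq^{\frac12 n^2}\cos(2n\pi z)$. Put $k=\theta_2(0,\tau)^2/\theta_3(0,\tau)^2$, $\lambda(\tau)=k^2$, $K=\frac{\pi}{2}\theta_3(0,\tau)^2$. The Jacobi elliptic function $\mathrm{cs}=\mathrm{cn}/\mathrm{sn}$ satisfies $$\mathrm{cs}(2Kz,k)=\frac{\theta_4(0,\tau)}{\theta_3(0,\tau)}\,\frac{\theta_2(z,\tau)}{\theta_1(z,\tau)}.$$ Let $U^{o}=\{(a;b)\in(\mathbb Z\setminus\{0\})\times\mathbb Z_{>0} : \gcd(a,b)=1,\ a+b\text{ odd}\}$.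 The elliptic classical Dedekind sum is $$s_\tau(a;b)=\frac{1}{4b}\sum_{\substack{0\le\mu,\nu\le b-1\\(\mu,\nu)\ne(0,0)}}(-1)^{\mu}\,\mathrm{cs}\!\left(2Ka\tfrac{\mu\tau+\nu}{b},k\right)\mathrm{cs}\!\left(2K\tfrac{\mu\tau+\nu}{b},k\right),\qquad s_\tau(a;1)=0 .$$ For $(a;b)\in U^{o}$, $Q(a;b)$ denotes the unique rational number, independent of $\tau$ (its existence is a known fact), such that $s_\tau(a;b)=Q(a;b)\left(\frac13-\frac16\lambda(\tau)\right)$. *)

theory Defs
  imports "HOL-Analysis.Analysis"
begin

text \<open>Fractional powers of the nome \<open>q = exp (2 \<pi> \<i> \<tau>)\<close> are taken in terms of \<open>\<tau>\<close>, not of the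
  number \<open>q\<close>; the principal branch of \<open>powr\<close> would give different values.\<close>

definition qpow :: "complex \<Rightarrow> real \<Rightarrow> complex" where
  "qpow \<tau> r = exp (2 * of_real pi * \<i> * of_real r * \<tau>)"

definition theta1 :: "complex \<Rightarrow> complex \<Rightarrow> complex" where
  "theta1 z \<tau> = 2 * (\<Sum>n. (-1) ^ n * qpow \<tau> (1/2 * (real n + 1/2)\<^sup>2)
                          * sin ((2 * of_nat n + 1) * of_real pi * z))"

definition theta2 :: "complex \<Rightarrow> complex \<Rightarrow> complex" where
  "theta2 z \<tau> = 2 * (\<Sum>n. qpow \<tau> (1/2 * (real n + 1/2)\<^sup>2)
                          * cos ((2 * of_nat n + 1) * of_real pi * z))"

text \<open>The sums over \<open>n \<ge> 1\<close> are indexed by \<open>Suc n\<close>.\<close>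

definition theta3 :: "complex \<Rightarrow> complex \<Rightarrow> complex" where
  "theta3 z \<tau> = 1 + 2 * (\<Sum>n. qpow \<tau> (1/2 * (real (Suc n))\<^sup>2)
                              * cos (2 * of_nat (Suc n) * of_real pi * z))"

definition theta4 :: "complex \<Rightarrow> complex \<Rightarrow> complex" where
  "theta4 z \<tau> = 1 + 2 * (\<Sum>n. (-1) ^ Suc n * qpow \<tau> (1/2 * (real (Suc n))\<^sup>2)
                              * cos (2 * of_nat (Suc n) * of_real pi * z))"

definition elliptic_k :: "complex \<Rightarrow> complex" where
  "elliptic_k \<tau> = (theta2 0 \<tau>)\<^sup>2 / (theta3 0 \<tau>)\<^sup>2"

definition elliptic_lambda :: "complex \<Rightarrow> complex" where
  "elliptic_lambda \<tau> = (elliptic_k \<tau>)\<^sup>2"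

definition elliptic_K :: "complex \<Rightarrow> complex" where
  "elliptic_K \<tau> = of_real pi / 2 * (theta3 0 \<tau>)\<^sup>2"

text \<open>The Jacobi elliptic function \<open>cs(u, k) = cn(u, k) / sn(u, k)\<close> of modulus \<open>k = elliptic_k \<tau>\<close>,
  given by its theta quotient
  \<open>cs(2Kz, k) = (\<theta>\<^sub>4(0,\<tau>) / \<theta>\<^sub>3(0,\<tau>)) (\<theta>\<^sub>2(z,\<tau>) / \<theta>\<^sub>1(z,\<tau>))\<close> with \<open>u = 2Kz\<close>.
  It is indexed by \<open>\<tau>\<close>, which determines both \<open>k\<close> and \<open>K\<close>. A literal quotient of total functions
  \<open>cn\<close> and \<open>sn\<close> would be wrong at their common poles, where \<open>cs\<close> is finite.\<close>

definition jacobi_cs :: "complex \<Rightarrow> complex \<Rightarrow> complex" where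
  "jacobi_cs u \<tau> = theta4 0 \<tau> / theta3 0 \<tau> *
     (theta2 (u / (2 * elliptic_K \<tau>)) \<tau> / theta1 (u / (2 * elliptic_K \<tau>)) \<tau>)"

definition Uo :: "(int \<times> int) set" where
  "Uo = {(a, b). a \<noteq> 0 \<and> b > 0 \<and> gcd a b = 1 \<and> odd (a + b)}"

text \<open>For \<open>b = 1\<close> the sum is empty, so that \<open>s\<^sub>\<tau>(a;1) = 0\<close>.\<close>

definition elliptic_dedekind_sum :: "complex \<Rightarrow> int \<Rightarrow> int \<Rightarrow> complex" where
  "elliptic_dedekind_sum \<tau> a b = 1 / (4 * of_int b) *
     (\<Sum>(\<mu>, \<nu>) \<in> {0..b - 1} \<times> {0..b - 1} - {(0, 0)}.
        (-1) powi \<mu>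
        * jacobi_cs (2 * elliptic_K \<tau> * of_int a * ((of_int \<mu> * \<tau> + of_int \<nu>) / of_int b)) \<tau>
        * jacobi_cs (2 * elliptic_K \<tau> * ((of_int \<mu> * \<tau> + of_int \<nu>) / of_int b)) \<tau>)"

definition Q :: "int \<Rightarrow> int \<Rightarrow> rat" where
  "Q a b = (THE r. \<forall>\<tau>. Im \<tau> > 0 \<longrightarrow>
     elliptic_dedekind_sum \<tau> a b = of_rat r * (1/3 - 1/6 * elliptic_lambda \<tau>))"

end

theory Submission
  imports Defs "HOL-Complex_Analysis.Complex_Analysis"
begin

text \<open>The function \<open>cs(2Kz)\<close> is a multiple \<open>c g(z)\<close> of an odd function \<open>g\<close> with multipliers \<open>1\<close> and \<open>-1\<close>
  under \<open>z \<mapsto> z + 1\<close> and \<open>z \<mapsto> z + \<tau>\<close>, whose only poles are the lattice points, with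
  \<open>g(z) = 1/z + e z + O(z\<^sup>3)\<close>. For coprime positive \<open>a\<close>, \<open>b\<close> with \<open>a + b\<close> odd, \<open>g(az) g(bz)\<close> has the same
  multipliers as \<open>g\<close>; subtracting translates of \<open>g\<close> and a multiple of \<open>g'\<close> that cancel all poles leaves
  an entire function, which vanishes by Liouville's theorem. Its value at \<open>0\<close> is the reciprocity law
  \<open>s\<^sub>\<tau>(a;b) + s\<^sub>\<tau>(b;a) = - c\<^sup>2 e (a\<^sup>2 + b\<^sup>2 + 1) / (4ab)\<close>. The classical relations between the three
  quotients \<open>\<theta>\<^sub>i / \<theta>\<^sub>1\<close> give \<open>- 6 c\<^sup>2 e = 1 + (\<theta>\<^sub>4(0) / \<theta>\<^sub>3(0))\<^sup>4 = 2 - \<lambda>\<close>; the value of \<open>\<theta>\<^sub>1'(0)\<close> cancels,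
  so that Jacobi's derivative formula is not needed. Together with \<open>s\<^sub>\<tau>(a + 2b; b) = s\<^sub>\<tau>(a; b)\<close> and oddness
  in \<open>a\<close>, the Euclidean algorithm yields \<open>Q(a; b)\<close> and the congruences for \<open>4bQ(a; b)\<close>.\<close>

section \<open>Removable singularities and Liouville's theorem\<close>

text \<open>The value \<open>f z\<close> is ignored: quotients take the default
  \<open>x / 0 = 0\<close> at their poles, so only punctured neighbourhoods carry
  information.\<close>

definition removable :: "(complex \<Rightarrow> complex) \<Rightarrow> complex \<Rightarrow> bool" where
  "removable f z \<longleftrightarrow> (\<exists>h. h analytic_on {z} \<and> (\<forall>\<^sub>F w in at z. f w = h w))"

lemma removableI:
  assumes "h analytic_on {z}" "\<forall>\<^sub>F w in at z. f w = h w"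
  shows "removable f z"
  using assms by (auto simp: removable_def)

lemma removable_analytic: "f analytic_on {z} \<Longrightarrow> removable f z"
  by (rule removableI) auto

lemma removable_cong:
  assumes "removable g z" "\<forall>\<^sub>F w in at z. f w = g w"
  shows "removable f z"
proof -
  from assms(1) obtain h where h: "h analytic_on {z}" "\<forall>\<^sub>F w in at z. g w = h w"
    by (auto simp: removable_def)
  from assms(2) h(2) have "\<forall>\<^sub>F w in at z. f w = h w"
    by eventually_elim auto
  with h(1) show ?thesis by (rule removableI)
qed

lemma removable_add:
  assumes "removable f z" "removable g z"
  shows "removable (\<lambda>w. f w + g w) z"
proof -
  from assms obtain h k where h: "h analytic_on {z}" "\<forall>\<^sub>F w in at z. f w = h w"
    and k: "k analytic_on {z}" "\<forall>\<^sub>F w in at z. g w = k w"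
    by (auto simp: removable_def)
  from h(2) k(2) have "\<forall>\<^sub>F w in at z. f w + g w = h w + k w"
    by eventually_elim auto
  then show ?thesis by (rule removableI[rotated]) (intro analytic_intros h k)
qed

lemma removable_mult:
  assumes "removable f z" "removable g z"
  shows "removable (\<lambda>w. f w * g w) z"
proof -
  from assms obtain h k where h: "h analytic_on {z}" "\<forall>\<^sub>F w in at z. f w = h w"
    and k: "k analytic_on {z}" "\<forall>\<^sub>F w in at z. g w = k w"
    by (auto simp: removable_def)
  from h(2) k(2) have "\<forall>\<^sub>F w in at z. f w * g w = h w * k w"
    by eventually_elim auto
  then show ?thesis by (rule removableI[rotated]) (intro analytic_intros h k)
qed

lemma removable_const: "removable (\<lambda>w. c) z"
  by (intro removable_analytic analytic_intros)

lemma eventually_at_shift: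
  fixes c z :: "'a :: real_normed_vector"
  shows "(\<forall>\<^sub>F w in at z. P (w + c)) \<longleftrightarrow> (\<forall>\<^sub>F w in at (z + c). P w)"
  by (subst (2) at_to_0, subst at_to_0) (auto simp: eventually_filtermap add_ac)

lemma removable_shift:
  assumes "removable f (z + c)"
  shows "removable (\<lambda>w. f (w + c)) z"
proof -
  from assms obtain h where h: "h analytic_on {z + c}" "\<forall>\<^sub>F w in at (z + c). f w = h w"
    by (auto simp: removable_def)
  have "(h \<circ> (\<lambda>w. w + c)) analytic_on {z}"
    by (rule analytic_on_compose) (auto intro!: analytic_intros h)
  moreover have "\<forall>\<^sub>F w in at z. f (w + c) = (h \<circ> (\<lambda>w. w + c)) w"
    using h(2) unfolding o_def by (subst eventually_at_shift)
  ultimately show ?thesis by (rule removableI)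
qed

lemma analytic_difference_quotient:
  assumes "f analytic_on {a}"
  shows "(\<lambda>z. if z = a then deriv f a else (f z - f a) / (z - a)) analytic_on {a}"
proof -
  have "(\<lambda>z. if z = a then deriv f a else f z / (z - a) - f a / (z - a)) analytic_on {a}"
    by (rule pole_theorem_analytic[OF assms]) (auto intro!: exI[of _ 1])
  moreover have "(\<lambda>z. if z = a then deriv f a else f z / (z - a) - f a / (z - a)) =
      (\<lambda>z. if z = a then deriv f a else (f z - f a) / (z - a))"
    by (auto simp: diff_divide_distrib)
  ultimately show ?thesis by simp
qed

lemma removable_difference_quotient:
  assumes "f analytic_on {a}"
  shows "removable (\<lambda>z. (f z - f a) / (z - a)) a"
  by (rule removableI[OF analytic_difference_quotient[OF assms]])
     (auto simp: eventually_at intro!: exI[of _ 1])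

lemma powi_multiplier:
  fixes f :: "complex \<Rightarrow> complex"
  assumes "\<And>z. f (z + \<omega>) = \<epsilon> * f z" "\<epsilon> \<noteq> 0"
  shows "f (z + of_int m * \<omega>) = \<epsilon> powi m * f z"
proof (induction m rule: int_induct[where k = 0])
  case (step1 i)
  have "f (z + of_int (i + 1) * \<omega>) = f ((z + of_int i * \<omega>) + \<omega>)"
    by (simp add: algebra_simps)
  also have "\<dots> = \<epsilon> powi (i + 1) * f z"
    using assms(2) by (simp add: assms(1) step1 power_int_add)
  finally show ?case .
next
  case (step2 i)
  have "\<epsilon> * f (z + of_int (i - 1) * \<omega>) = f ((z + of_int (i - 1) * \<omega>) + \<omega>)"
    by (simp only: assms(1))
  also have "\<dots> = \<epsilon> powi i * f z"
    using step2 by (simp add: algebra_simps)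
  also have "\<epsilon> powi i = \<epsilon> * \<epsilon> powi (i - 1)"
    using assms(2) by (simp add: power_int_diff)
  finally show ?case using assms(2) by simp
qed simp

lemma lattice_coordinates:
  assumes "Im \<tau> \<noteq> 0"
  obtains s t :: real where "z = of_real s * \<tau> + of_real t"
proof
  show "z = of_real (Im z / Im \<tau>) * \<tau> + of_real (Re z - Im z / Im \<tau> * Re \<tau>)"
    using assms by (simp add: complex_eq_iff)
qed

lemma lattice_coordinates_unique:
  assumes "Im \<tau> \<noteq> 0" "of_real s * \<tau> + of_real t = of_real s' * \<tau> + of_real t'"
  shows "s = s' \<and> t = t'"
  using assms by (auto simp: complex_eq_iff)

text \<open>Filling in the limits gives an entire function whose absolute value is doubly periodic,
  because both multipliers are unimodular; it is therefore bounded by its maximum over a compact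
  period parallelogram. The equations for \<open>C\<close> force \<open>C = 0\<close> as soon as one
  multiplier differs from 1.\<close>

theorem liouville_quasiperiodic:
  fixes f :: "complex \<Rightarrow> complex"
  assumes \<tau>: "Im \<tau> > 0"
    and 1: "\<And>z. f (z + 1) = \<epsilon>1 * f z" "norm \<epsilon>1 = 1"
    and 2: "\<And>z. f (z + \<tau>) = \<epsilon>2 * f z" "norm \<epsilon>2 = 1"
    and rem: "\<And>z. removable f z"
  obtains C where "\<And>z. \<forall>\<^sub>F w in at z. f w = C" "C = \<epsilon>1 * C" "C = \<epsilon>2 * C"
proof -
  define F where "F = (\<lambda>z. Lim (at z) f)"
  have F: "F analytic_on {z} \<and> (\<forall>\<^sub>F w in at z. f w = F w)" for z
  proof -
    from rem[of z] obtain h where h: "h analytic_on {z}" "\<forall>\<^sub>F w in at z. f w = h w"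
      by (auto simp: removable_def)
    have ana: "\<forall>\<^sub>F w in nhds z. h analytic_on {w}"
      using h(1) by (metis analytic_at eventually_nhds holomorphic_on_imp_analytic_at)
    have "\<forall>\<^sub>F w in nhds z. w \<noteq> z \<longrightarrow> f w = h w"
      using h(2) by (simp add: eventually_at_filter)
    \<comment> \<open>\<open>F w\<close> depends on \<open>f\<close> near \<open>w\<close>, so the
      agreement of \<open>f\<close> and \<open>h\<close> near \<open>z\<close> has to be passed on
      to a neighbourhood of each nearby \<open>w\<close>.\<close>
    then have "\<forall>\<^sub>F w in nhds z. \<forall>\<^sub>F x in nhds w. x \<noteq> z \<longrightarrow> f x = h x"
      by (simp add: eventually_eventually)
    with ana have eq: "\<forall>\<^sub>F w in nhds z. F w = h w"
    proof eventually_elim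
      case (elim w)
      have *: "\<forall>\<^sub>F x in at w. f x = h x"
      proof (cases "w = z")
        case True
        then show ?thesis using h(2) by simp
      next
        case False
        then have "\<forall>\<^sub>F x in nhds w. x \<noteq> z"
          by (rule t1_space_nhds)
        with elim(2) have "\<forall>\<^sub>F x in nhds w. f x = h x"
          by eventually_elim auto
        then show ?thesis by (simp add: eventually_at_filter eventually_mono)
      qed
      have "isCont h w"
        using elim(1) by (rule analytic_at_imp_isCont)
      then have "h \<midarrow>w\<rightarrow> h w" by (simp add: isCont_def)
      then have "f \<midarrow>w\<rightarrow> h w"
        using * by (simp add: filterlim_cong)
      then show ?case unfolding F_def by (intro tendsto_Lim) auto
    qed
    have "F analytic_on {z}"
      using h(1) analytic_at_cong[OF eq refl] by blast
    moreover have "\<forall>\<^sub>F w in at z. F w = h w"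
      using eq by (simp add: eventually_at_filter eventually_mono)
    with h(2) have "\<forall>\<^sub>F w in at z. f w = F w" by eventually_elim auto
    ultimately show ?thesis by blast
  qed
  have lim: "f \<midarrow>z\<rightarrow> F z" for z
  proof -
    have "isCont F z" using F[of z] by (auto intro: analytic_at_imp_isCont)
    then have "F \<midarrow>z\<rightarrow> F z" by (simp add: isCont_def)
    moreover have "\<forall>\<^sub>F w in at z. F w = f w"
      using F[of z] by (simp add: eq_commute)
    ultimately show ?thesis using Lim_transform_eventually by blast
  qed
  have per: "F (z + \<omega>) = \<epsilon> * F z" if "\<And>z. f (z + \<omega>) = \<epsilon> * f z" for z \<omega> \<epsilon>
  proof -
    have "(\<lambda>w. f (w + \<omega>)) \<midarrow>z\<rightarrow> F (z + \<omega>)"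
      using LIM_offset[OF lim[of "z + \<omega>"], of \<omega>] by simp
    moreover have "(\<lambda>w. f (w + \<omega>)) \<midarrow>z\<rightarrow> \<epsilon> * F z"
      unfolding that by (intro tendsto_intros lim)
    ultimately show ?thesis by (rule LIM_unique)
  qed
  have hol: "F holomorphic_on UNIV"
    using F by (meson analytic_imp_holomorphic analytic_on_analytic_at)
  define G where "G = (\<lambda>(s::real, t::real). F (of_real s * \<tau> + of_real t))"
  have "compact (G ` ({0..1} \<times> {0..1}))"
  proof (rule compact_continuous_image)
    have "continuous_on UNIV F" using hol by (rule holomorphic_on_imp_continuous_on)
    then show "continuous_on ({0..1} \<times> {0..1}) G"
      unfolding G_def case_prod_unfold
      by (rule continuous_on_compose2) (auto intro!: continuous_intros)
  qed (intro compact_Times compact_Icc)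
  then have "bounded (G ` ({0..1} \<times> {0..1}))" by (rule compact_imp_bounded)
  moreover have "range F \<subseteq> cball 0 B" if B: "\<And>x. x \<in> G ` ({0..1} \<times> {0..1}) \<Longrightarrow> norm x \<le> B" for B
  proof clarify
    fix z
    obtain s t :: real where z: "z = of_real s * \<tau> + of_real t"
      using \<tau> lattice_coordinates[of \<tau> z] by auto
    define y where "y = of_real (frac s) * \<tau> + of_real (frac t)"
    have z': "z = (y + of_int \<lfloor>t\<rfloor> * 1) + of_int \<lfloor>s\<rfloor> * \<tau>"
      by (simp add: y_def z frac_def algebra_simps)
    have ne: "\<epsilon>1 \<noteq> 0" "\<epsilon>2 \<noteq> 0" using 1(2) 2(2) by auto
    have "F z = \<epsilon>2 powi \<lfloor>s\<rfloor> * (\<epsilon>1 powi \<lfloor>t\<rfloor> * F y)"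
      unfolding z' using powi_multiplier[of F 1 \<epsilon>1, OF per[OF 1(1)] ne(1)]
        powi_multiplier[of F \<tau> \<epsilon>2, OF per[OF 2(1)] ne(2)] by simp
    then have "norm (F z) = norm (F y)"
      by (simp add: norm_mult norm_power_int 1(2) 2(2))
    also have "F y = G (frac s, frac t)" by (simp add: G_def y_def)
    also have "norm \<dots> \<le> B" by (rule B) (auto simp: frac_lt_1 less_imp_le)
    finally show "F z \<in> cball 0 B" by simp
  qed
  ultimately have "bounded (range F)"
    unfolding bounded_iff[of "G ` _"] by (meson bounded_cball bounded_subset)
  then obtain C where C: "\<And>z. F z = C"
    using Liouville_theorem[OF hol] by (auto simp: constant_on_def)
  show thesis
  proof
    show "\<forall>\<^sub>F w in at z. f w = C" for z using F[of z] C by simp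
    show "C = \<epsilon>1 * C" "C = \<epsilon>2 * C"
      using per[OF 1(1), of 0] per[OF 2(1), of 0] C by auto
  qed
qed

section \<open>The theta series\<close>

text \<open>Ratio test: consecutive terms have quotient \<open>r n * x\<close>, which tends to 0 for
  every \<open>x\<close>.\<close>

lemma powser_ratio_entire:
  fixes c r :: "nat \<Rightarrow> complex"
  assumes "\<And>n. c (Suc n) = r n * c n" "r \<longlonglongrightarrow> 0"
  shows "summable (\<lambda>n. c n * x ^ n)" "(\<lambda>x. \<Sum>n. c n * x ^ n) holomorphic_on UNIV"
proof -
  have s: "summable (\<lambda>n. c n * x ^ n)" for x
  proof -
    have "(\<lambda>n. norm (r n * x)) \<longlonglongrightarrow> norm (0 * x)"
      by (intro tendsto_intros assms)
    then have "\<forall>\<^sub>F n in sequentially. norm (r n * x) < 1/2"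
      by (rule order_tendstoD) auto
    then obtain N where N: "\<And>n. n \<ge> N \<Longrightarrow> norm (r n * x) < 1/2"
      by (auto simp: eventually_at_top_linorder)
    show ?thesis
    proof (rule summable_ratio_test)
      show "norm (c (Suc n) * x ^ Suc n) \<le> 1/2 * norm (c n * x ^ n)" if "n \<ge> N" for n
      proof -
        have "norm (c (Suc n) * x ^ Suc n) = norm (r n * x) * norm (c n * x ^ n)"
          by (simp add: assms(1) norm_mult norm_power)
        also have "\<dots> \<le> 1/2 * norm (c n * x ^ n)"
          using N[OF that] by (intro mult_right_mono) auto
        finally show ?thesis .
      qed
    qed auto
  qed
  show "summable (\<lambda>n. c n * x ^ n)" by (rule s)
  show "(\<lambda>x. \<Sum>n. c n * x ^ n) holomorphic_on UNIV"
    using termdiffs_strong_converges_everywhere[OF s] by (auto simp: holomorphic_on_open)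
qed

lemma qpow_add: "qpow \<tau> (r + s) = qpow \<tau> r * qpow \<tau> s"
  by (simp add: qpow_def exp_add[symmetric] algebra_simps)

lemma qpow_0 [simp]: "qpow \<tau> 0 = 1"
  by (simp add: qpow_def)

lemma qpow_nonzero [simp]: "qpow \<tau> r \<noteq> 0"
  by (simp add: qpow_def)

lemma qpow_power: "qpow \<tau> r ^ n = qpow \<tau> (of_nat n * r)"
  by (simp add: qpow_def exp_of_nat_mult[symmetric] mult_ac)

lemma norm_qpow: "norm (qpow \<tau> r) = exp (- 2 * pi * r * Im \<tau>)"
  by (simp add: qpow_def)

definition theta_coeff :: "complex \<Rightarrow> nat \<Rightarrow> complex" where
  "theta_coeff \<tau> n = qpow \<tau> (1/2 * (real n)\<^sup>2)"

text \<open>The part \<open>n \<ge> 0\<close> of Jacobi's bilateral series in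
  \<open>x = unit_exp z\<close>. Being a power series, it is entire in \<open>x\<close> also at
  \<open>x = 0\<close>.\<close>

definition theta_half :: "complex \<Rightarrow> complex \<Rightarrow> complex" where
  "theta_half \<tau> x = (\<Sum>n. theta_coeff \<tau> n * x ^ n)"

text \<open>In closed form \<open>(-1)^n q^(n(n+1)/2) / ((1 - q) ... (1 - q^n))\<close>.\<close>

definition euler_coeff :: "complex \<Rightarrow> nat \<Rightarrow> complex" where
  "euler_coeff \<tau> n = (\<Prod>k<n. - qpow \<tau> (real (Suc k)) / (1 - qpow \<tau> (real (Suc k))))"

text \<open>Euler's expansion of \<open>\<Prod>\<^sub>n\<^sub>\<ge>\<^sub>1 (1 - q\<^sup>n x)\<close>; only the functional equation is used.\<close>

definition euler_fun :: "complex \<Rightarrow> complex \<Rightarrow> complex" where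
  "euler_fun \<tau> x = (\<Sum>n. euler_coeff \<tau> n * x ^ n)"

context
  fixes \<tau> :: complex
  assumes \<tau>: "Im \<tau> > 0"
begin

lemma qpow_tendsto_0: "(\<lambda>n. qpow \<tau> (real n)) \<longlonglongrightarrow> 0"
proof -
  have "norm (qpow \<tau> 1) < 1" using \<tau> by (simp add: norm_qpow)
  then have "(\<lambda>n. qpow \<tau> 1 ^ n) \<longlonglongrightarrow> 0" by (rule LIMSEQ_power_zero)
  then show ?thesis by (simp add: qpow_power)
qed

lemma qpow_neq_1: "r > 0 \<Longrightarrow> qpow \<tau> r \<noteq> 1"
proof
  assume "r > 0" "qpow \<tau> r = 1"
  then have "norm (qpow \<tau> r) = 1" by simp
  with \<open>r > 0\<close> \<tau> show False by (simp add: norm_qpow)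
qed

lemma theta_coeff_Suc: "theta_coeff \<tau> (Suc n) = (qpow \<tau> (1/2) * qpow \<tau> (real n)) * theta_coeff \<tau> n"
  unfolding theta_coeff_def qpow_add[symmetric] by (simp add: power2_eq_square algebra_simps)

lemma theta_coeff_ratio: "(\<lambda>n. qpow \<tau> (1/2) * qpow \<tau> (real n)) \<longlonglongrightarrow> 0"
  by (rule tendsto_mult_right_zero[OF qpow_tendsto_0])

lemmas theta_half_summable = powser_ratio_entire(1)[of "theta_coeff \<tau>", OF theta_coeff_Suc theta_coeff_ratio]

lemma theta_half_holomorphic: "theta_half \<tau> holomorphic_on UNIV"
  unfolding theta_half_def[abs_def]
  by (rule powser_ratio_entire(2)[of "theta_coeff \<tau>", OF theta_coeff_Suc theta_coeff_ratio])

lemma theta_half_0 [simp]: "theta_half \<tau> 0 = 1"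
  unfolding theta_half_def by (subst powser_zero) (simp add: theta_coeff_def)

text \<open>The term \<open>n = 0\<close> is split off and \<open>(n + 1)^2 = n^2 + 2 n + 1\<close>
  is used for the others. One-sidedness leaves the inhomogeneous term 1, which cancels once two
  halves are added.\<close>

lemma theta_half_shift:
  "theta_half \<tau> x = 1 + qpow \<tau> (1/2) * x * theta_half \<tau> (qpow \<tau> 1 * x)"
proof -
  have "theta_half \<tau> x = (\<Sum>n. theta_coeff \<tau> (Suc n) * x ^ Suc n) + 1"
    unfolding theta_half_def by (subst suminf_split_head[OF theta_half_summable]) (simp add: theta_coeff_def)
  also have "(\<lambda>n. theta_coeff \<tau> (Suc n) * x ^ Suc n) =
      (\<lambda>n. qpow \<tau> (1/2) * x * (theta_coeff \<tau> n * (qpow \<tau> 1 * x) ^ n))"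
    by (rule ext) (simp add: theta_coeff_Suc power_mult_distrib qpow_power)
  also have "suminf \<dots> = qpow \<tau> (1/2) * x * theta_half \<tau> (qpow \<tau> 1 * x)"
    unfolding theta_half_def by (rule suminf_mult[OF theta_half_summable])
  finally show ?thesis by simp
qed

lemma euler_coeff_Suc:
  "euler_coeff \<tau> (Suc n) = (- qpow \<tau> (real (Suc n)) / (1 - qpow \<tau> (real (Suc n)))) * euler_coeff \<tau> n"
  by (simp add: euler_coeff_def)

lemma euler_coeff_ratio: "(\<lambda>n. - qpow \<tau> (real (Suc n)) / (1 - qpow \<tau> (real (Suc n)))) \<longlonglongrightarrow> 0"
proof -
  have "(\<lambda>n. - qpow \<tau> (real (Suc n)) / (1 - qpow \<tau> (real (Suc n)))) \<longlonglongrightarrow> - 0 / (1 - 0)"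
    by (intro tendsto_intros LIMSEQ_Suc[OF qpow_tendsto_0]) auto
  then show ?thesis by simp
qed

lemmas euler_summable = powser_ratio_entire(1)[of "euler_coeff \<tau>", OF euler_coeff_Suc euler_coeff_ratio]

lemma euler_fun_holomorphic: "euler_fun \<tau> holomorphic_on UNIV"
  unfolding euler_fun_def[abs_def]
  by (rule powser_ratio_entire(2)[of "euler_coeff \<tau>", OF euler_coeff_Suc euler_coeff_ratio])

lemma euler_fun_0 [simp]: "euler_fun \<tau> 0 = 1"
  unfolding euler_fun_def by (subst powser_zero) (simp add: euler_coeff_def)

text \<open>Comparison of coefficients: the recurrence says that \<open>(1 - q^(n+1))\<close> times
  coefficient \<open>n + 1\<close> is \<open>- q^(n+1)\<close> times coefficient
  \<open>n\<close>.\<close>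

lemma euler_fun_shift:
  "euler_fun \<tau> x = (1 - qpow \<tau> 1 * x) * euler_fun \<tau> (qpow \<tau> 1 * x)"
proof -
  define q where "q = qpow \<tau> 1"
  note S = euler_summable
  have q: "qpow \<tau> (real n) = q ^ n" for n by (simp add: q_def qpow_power)
  have rec: "euler_coeff \<tau> (Suc n) - euler_coeff \<tau> (Suc n) * q ^ Suc n = - (q ^ Suc n) * euler_coeff \<tau> n" for n
  proof -
    have cancel: "(- r / (1 - r) * c) * (1 - r) = - r * c" if "1 - r \<noteq> 0" for r c :: complex
      using that by simp
    have ne: "1 - q ^ Suc n \<noteq> 0" using qpow_neq_1[of "real (Suc n)"] by (simp add: q del: of_nat_Suc)
    have "euler_coeff \<tau> (Suc n) - euler_coeff \<tau> (Suc n) * q ^ Suc n =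
        euler_coeff \<tau> (Suc n) * (1 - q ^ Suc n)"
      by (simp only: right_diff_distrib mult_1_right)
    also have "\<dots> = - (q ^ Suc n) * euler_coeff \<tau> n"
      unfolding euler_coeff_Suc q by (rule cancel[OF ne])
    finally show ?thesis .
  qed
  have S1: "summable (\<lambda>n. euler_coeff \<tau> (Suc n) * y ^ Suc n)" for y
    using S[of y] by (subst summable_Suc_iff)
  have head: "euler_fun \<tau> y = (\<Sum>n. euler_coeff \<tau> (Suc n) * y ^ Suc n) + 1" for y
    unfolding euler_fun_def by (subst suminf_split_head[OF S]) (simp add: euler_coeff_def)
  have "euler_fun \<tau> x - euler_fun \<tau> (q * x) =
      (\<Sum>n. euler_coeff \<tau> (Suc n) * x ^ Suc n - euler_coeff \<tau> (Suc n) * (q * x) ^ Suc n)"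
    unfolding head by (simp add: suminf_diff[OF S1 S1, symmetric] del: power_Suc)
  also have "(\<lambda>n. euler_coeff \<tau> (Suc n) * x ^ Suc n - euler_coeff \<tau> (Suc n) * (q * x) ^ Suc n) =
      (\<lambda>n. (- q * x) * (euler_coeff \<tau> n * (q * x) ^ n))"
  proof
    fix n
    have "euler_coeff \<tau> (Suc n) * x ^ Suc n - euler_coeff \<tau> (Suc n) * (q * x) ^ Suc n =
       (euler_coeff \<tau> (Suc n) - euler_coeff \<tau> (Suc n) * q ^ Suc n) * x ^ Suc n"
      by (simp add: power_mult_distrib algebra_simps)
    also have "\<dots> = (- q * x) * (euler_coeff \<tau> n * (q * x) ^ n)"
      unfolding rec by (simp add: power_mult_distrib algebra_simps)
    finally show "euler_coeff \<tau> (Suc n) * x ^ Suc n - euler_coeff \<tau> (Suc n) * (q * x) ^ Suc n =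
      (- q * x) * (euler_coeff \<tau> n * (q * x) ^ n)" .
  qed
  also have "suminf \<dots> = (- q * x) * euler_fun \<tau> (q * x)"
    unfolding euler_fun_def by (rule suminf_mult[OF S])
  finally show ?thesis unfolding q_def by (simp add: algebra_simps)
qed

lemma euler_fun_product:
  "euler_fun \<tau> x = (\<Prod>k<N. 1 - qpow \<tau> (real (Suc k)) * x) * euler_fun \<tau> (qpow \<tau> (real N) * x)"
proof (induction N)
  case (Suc N)
  have "qpow \<tau> 1 * (qpow \<tau> (real N) * x) = qpow \<tau> (real (Suc N)) * x"
    unfolding mult.assoc[symmetric] qpow_add[symmetric] by simp
  note shift = euler_fun_shift[of "qpow \<tau> (real N) * x", unfolded this]
  show ?case
    using Suc.IH unfolding shift by (simp add: mult_ac del: of_nat_Suc)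
qed simp

text \<open>In \<open>euler_fun_product\<close> the last argument tends to 0, where
  \<open>euler_fun\<close> is 1; for large \<open>N\<close> the last factor is nonzero, so a zero
  must come from one of the finitely many linear factors.\<close>

lemma euler_fun_eq_0:
  assumes "euler_fun \<tau> x = 0"
  obtains n :: nat where "n > 0" "qpow \<tau> (real n) * x = 1"
proof -
  have "isCont (euler_fun \<tau>) 0"
    using euler_fun_holomorphic by (meson UNIV_I analytic_at_imp_isCont holomorphic_on_imp_analytic_at open_UNIV)
  then have "euler_fun \<tau> \<midarrow>0\<rightarrow> euler_fun \<tau> 0" by (simp add: isCont_def)
  moreover have "(\<lambda>N. qpow \<tau> (real N) * x) \<longlonglongrightarrow> 0"
    by (rule tendsto_mult_left_zero[OF qpow_tendsto_0])
  ultimately have "(\<lambda>N. euler_fun \<tau> (qpow \<tau> (real N) * x)) \<longlonglongrightarrow> euler_fun \<tau> 0"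
    using isCont_tendsto_compose[OF \<open>isCont (euler_fun \<tau>) 0\<close>] by blast
  then have "\<forall>\<^sub>F N in sequentially. euler_fun \<tau> (qpow \<tau> (real N) * x) \<noteq> 0"
    by (rule tendsto_imp_eventually_ne) simp
  then obtain N where "euler_fun \<tau> (qpow \<tau> (real N) * x) \<noteq> 0"
    by (auto simp: eventually_at_top_linorder)
  with assms euler_fun_product[of x N] have "(\<Prod>k<N. 1 - qpow \<tau> (real (Suc k)) * x) = 0"
    by simp
  then obtain k where "qpow \<tau> (real (Suc k)) * x = 1" by auto
  then show thesis using that[of "Suc k"] by simp
qed

end

section \<open>The exponential \<open>e^(2 pi i z)\<close> and the period lattice\<close>

definition unit_exp :: "complex \<Rightarrow> complex" where
  "unit_exp z = exp (2 * of_real pi * \<i> * z)"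

lemma unit_exp_add: "unit_exp (x + y) = unit_exp x * unit_exp y"
  by (simp add: unit_exp_def exp_add[symmetric] algebra_simps)

lemma unit_exp_minus: "unit_exp (- x) = inverse (unit_exp x)"
  by (simp add: unit_exp_def exp_minus)

lemma unit_exp_nonzero [simp]: "unit_exp x \<noteq> 0"
  by (simp add: unit_exp_def)

lemma unit_exp_power: "unit_exp x ^ n = unit_exp (of_nat n * x)"
  by (simp add: unit_exp_def exp_of_nat_mult[symmetric] mult_ac)

lemma unit_exp_eq_1_iff: "unit_exp z = 1 \<longleftrightarrow> z \<in> \<int>"
proof -
  have "unit_exp z = 1 \<longleftrightarrow> Im z = 0 \<and> (\<exists>n::int. Re z = of_int n)"
    by (auto simp: unit_exp_def exp_eq_1)
  also have "\<dots> \<longleftrightarrow> z \<in> \<int>"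
    by (auto simp: Ints_def complex_eq_iff)
  finally show ?thesis .
qed

lemma unit_exp_0 [simp]: "unit_exp 0 = 1"
  by (simp add: unit_exp_def)

lemma unit_exp_1 [simp]: "unit_exp 1 = 1"
  by (simp add: unit_exp_eq_1_iff)

lemma unit_exp_half [simp]: "unit_exp (1/2) = - 1"
  by (simp add: unit_exp_def mult.assoc)

lemma qpow_unit_exp: "qpow \<tau> r = unit_exp (of_real r * \<tau>)"
  by (simp add: qpow_def unit_exp_def mult_ac)

lemma cos_unit_exp: "cos (2 * of_real pi * x) = (unit_exp x + unit_exp (- x)) / 2"
  by (simp add: cos_exp_eq unit_exp_def mult_ac)

text \<open>Written so that \<open>1 - unit_exp x\<close> can cancel against an Euler factor in
  \<open>theta1_product_add_tau\<close>.\<close>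

lemma sin_pi_unit_exp: "sin (of_real pi * x) = \<i> / 2 * unit_exp (- x / 2) * (1 - unit_exp x)"
proof -
  have "unit_exp (- x / 2) * unit_exp x = unit_exp (x / 2)"
    by (simp add: unit_exp_add[symmetric])
  then have *: "\<i> / 2 * unit_exp (- x / 2) * (1 - unit_exp x) = \<i> / 2 * (unit_exp (- x / 2) - unit_exp (x / 2))"
    by (metis mult.assoc mult_1_right right_diff_distrib)
  show ?thesis unfolding * by (simp add: sin_exp_eq' unit_exp_def mult_ac)
qed

lemma analytic_unit_exp [analytic_intros]: "f analytic_on A \<Longrightarrow> (\<lambda>z. unit_exp (f z)) analytic_on A"
  unfolding unit_exp_def by (intro analytic_intros)

lemma unit_exp_surj:
  assumes "w \<noteq> 0"
  obtains z where "unit_exp z = w"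
  using that[of "Ln w / (2 * of_real pi * \<i>)"] assms by (simp add: unit_exp_def)

definition lattice :: "complex \<Rightarrow> complex set" where
  "lattice \<tau> = {of_int m * \<tau> + of_int n |m n. True}"

lemma latticeI: "z = of_int m * \<tau> + of_int n \<Longrightarrow> z \<in> lattice \<tau>"
  by (auto simp: lattice_def)

lemma latticeE:
  assumes "z \<in> lattice \<tau>"
  obtains m n where "z = of_int m * \<tau> + of_int n"
  using assms by (auto simp: lattice_def)

section \<open>The four theta functions as translates of \<open>theta3\<close>\<close>

lemma theta4_conv_theta3: "theta4 z \<tau> = theta3 (z + 1/2) \<tau>"
proof -
  have "(-1) ^ Suc n * cos (2 * of_nat (Suc n) * of_real pi * z) =
      cos (2 * of_nat (Suc n) * of_real pi * (z + 1/2))" for n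
  proof -
    have eq: "2 * of_nat (Suc n) * of_real pi * (z + 1/2) =
       2 * of_nat (Suc n) * of_real pi * z + of_real (real (Suc n) * pi)"
      by (simp add: algebra_simps)
    show ?thesis unfolding eq cos_add cos_of_real sin_of_real cos_npi sin_npi by simp
  qed
  then have *: "(-1) ^ Suc n * qpow \<tau> r * cos (2 * of_nat (Suc n) * of_real pi * z) =
      qpow \<tau> r * cos (2 * of_nat (Suc n) * of_real pi * (z + 1/2))" for n r
    by (metis mult.assoc mult.left_commute)
  show ?thesis unfolding theta4_def theta3_def * ..
qed

context
  fixes \<tau> :: complex
  assumes \<tau>: "Im \<tau> > 0"
begin

text \<open>Each cosine splits into a positive and a negative power of \<open>unit_exp z\<close>;
  both halves contain the term \<open>n = 0\<close>, hence the \<open>- 1\<close>.\<close>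

lemma theta3_conv_theta_half:
  "theta3 z \<tau> = theta_half \<tau> (unit_exp z) + theta_half \<tau> (unit_exp (- z)) - 1"
proof -
  note S = theta_half_summable[OF \<tau>]
  have S1: "summable (\<lambda>n. theta_coeff \<tau> (Suc n) * y ^ Suc n)" for y
    using S[of y] by (subst summable_Suc_iff)
  have head: "theta_half \<tau> y = (\<Sum>n. theta_coeff \<tau> (Suc n) * y ^ Suc n) + 1" for y
    unfolding theta_half_def by (subst suminf_split_head[OF S]) (simp add: theta_coeff_def)
  have "qpow \<tau> (1/2 * (real (Suc n))\<^sup>2) * cos (2 * of_nat (Suc n) * of_real pi * z) =
     1/2 * (theta_coeff \<tau> (Suc n) * unit_exp z ^ Suc n + theta_coeff \<tau> (Suc n) * unit_exp (- z) ^ Suc n)" for n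
  proof -
    have c: "cos (2 * of_nat (Suc n) * of_real pi * z) =
        (unit_exp (of_nat (Suc n) * z) + unit_exp (of_nat (Suc n) * (- z))) / 2"
      using cos_unit_exp[of "of_nat (Suc n) * z"] by (simp add: mult_ac del: of_nat_Suc)
    show ?thesis unfolding c unit_exp_power theta_coeff_def by (simp add: algebra_simps)
  qed
  then have "theta3 z \<tau> = 1 + 2 * (\<Sum>n. 1/2 * (theta_coeff \<tau> (Suc n) * unit_exp z ^ Suc n +
      theta_coeff \<tau> (Suc n) * unit_exp (- z) ^ Suc n))"
    unfolding theta3_def by (simp only:)
  also have "\<dots> = 1 + ((\<Sum>n. theta_coeff \<tau> (Suc n) * unit_exp z ^ Suc n) +
      (\<Sum>n. theta_coeff \<tau> (Suc n) * unit_exp (- z) ^ Suc n))"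
    by (subst suminf_mult[OF summable_add[OF S1 S1]], subst suminf_add[OF S1 S1]) simp
  finally show ?thesis by (simp add: head)
qed

text \<open>Stated with \<open>sums\<close> so that it also yields the summability used in
  \<open>theta1_conv_theta2\<close>.\<close>

lemma theta2_sums:
  "(\<lambda>n. qpow \<tau> (1/2 * (real n + 1/2)\<^sup>2) * cos ((2 * of_nat n + 1) * of_real pi * z)) sums
     (1/2 * qpow \<tau> (1/8) * (unit_exp (z / 2) * theta_half \<tau> (unit_exp (\<tau> / 2 + z)) +
       unit_exp (- z / 2) * theta_half \<tau> (unit_exp (\<tau> / 2 - z))))"
proof -
  note S = summable_sums[OF theta_half_summable[OF \<tau>], folded theta_half_def]
  have "(\<lambda>n. 1/2 * qpow \<tau> (1/8) * (unit_exp (z / 2) * (theta_coeff \<tau> n * unit_exp (\<tau> / 2 + z) ^ n) +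
       unit_exp (- z / 2) * (theta_coeff \<tau> n * unit_exp (\<tau> / 2 - z) ^ n))) sums
     (1/2 * qpow \<tau> (1/8) * (unit_exp (z / 2) * theta_half \<tau> (unit_exp (\<tau> / 2 + z)) +
       unit_exp (- z / 2) * theta_half \<tau> (unit_exp (\<tau> / 2 - z))))"
    by (intro sums_mult sums_add S)
  moreover have "qpow \<tau> (1/2 * (real n + 1/2)\<^sup>2) * cos ((2 * of_nat n + 1) * of_real pi * z) =
     1/2 * qpow \<tau> (1/8) * (unit_exp (z / 2) * (theta_coeff \<tau> n * unit_exp (\<tau> / 2 + z) ^ n) +
       unit_exp (- z / 2) * (theta_coeff \<tau> n * unit_exp (\<tau> / 2 - z) ^ n))" for n
  proof -
    have c: "cos ((2 * of_nat n + 1) * of_real pi * z) =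
      (unit_exp (of_nat n * z + z / 2) + unit_exp (- (of_nat n * z + z / 2))) / 2"
      unfolding cos_unit_exp[symmetric] by (simp add: algebra_simps)
    \<comment> \<open>From \<open>(n + 1/2)^2 / 2 = 1/8 + n^2/2 + n/2\<close>; the part
      \<open>n/2\<close> is absorbed into the arguments \<open>\<tau> / 2 + z\<close> and
      \<open>\<tau> / 2 - z\<close>.\<close>
    have q: "qpow \<tau> (1/2 * (real n + 1/2)\<^sup>2) = qpow \<tau> (1/8) * theta_coeff \<tau> n * unit_exp (of_nat n * (\<tau> / 2))"
      unfolding theta_coeff_def qpow_unit_exp unit_exp_add[symmetric]
      by (rule arg_cong[of _ _ unit_exp]) (simp add: power2_eq_square algebra_simps)
    have p: "unit_exp (\<tau> / 2 + z) ^ n = unit_exp (of_nat n * (\<tau> / 2)) * unit_exp (of_nat n * z)"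
      "unit_exp (\<tau> / 2 - z) ^ n = unit_exp (of_nat n * (\<tau> / 2)) * unit_exp (- (of_nat n * z))"
      unfolding unit_exp_power unit_exp_add[symmetric] by (simp_all add: algebra_simps)
    have m: "unit_exp (- (of_nat n * z + z / 2)) = unit_exp (- (of_nat n * z)) * unit_exp (- z / 2)"
      unfolding unit_exp_add[symmetric] by simp
    show ?thesis unfolding c q p m unfolding unit_exp_add by (simp add: algebra_simps)
  qed
  ultimately show ?thesis by (simp only:)
qed

lemma theta1_conv_theta2: "theta1 z \<tau> = - theta2 (z + 1/2) \<tau>"
proof -
  have c: "cos ((2 * of_nat n + 1) * of_real pi * (z + 1/2)) =
      - ((-1) ^ n * sin ((2 * of_nat n + 1) * of_real pi * z))" for n
  proof -
    have eq: "(2 * of_nat n + 1) * of_real pi * (z + 1/2) =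
       (2 * of_nat n + 1) * of_real pi * z + of_real (real n * pi + pi / 2)"
      by (simp add: algebra_simps)
    have c: "cos (real n * pi + pi / 2) = 0" "sin (real n * pi + pi / 2) = (-1) ^ n"
      by (simp_all add: cos_add sin_add)
    show ?thesis unfolding eq cos_add cos_of_real sin_of_real c by simp
  qed
  have "(\<lambda>n. - (qpow \<tau> (1/2 * (real n + 1/2)\<^sup>2) * cos ((2 * of_nat n + 1) * of_real pi * (z + 1/2)))) sums
     - (\<Sum>n. qpow \<tau> (1/2 * (real n + 1/2)\<^sup>2) * cos ((2 * of_nat n + 1) * of_real pi * (z + 1/2)))"
    by (intro sums_minus summable_sums sums_summable[OF theta2_sums])
  then have "(\<lambda>n. (-1) ^ n * qpow \<tau> (1/2 * (real n + 1/2)\<^sup>2) * sin ((2 * of_nat n + 1) * of_real pi * z)) sums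
     - (\<Sum>n. qpow \<tau> (1/2 * (real n + 1/2)\<^sup>2) * cos ((2 * of_nat n + 1) * of_real pi * (z + 1/2)))"
    unfolding c by (simp add: mult_ac)
  from sums_unique[OF this] show ?thesis
    unfolding theta1_def theta2_def by simp
qed

text \<open>With this, all four functions are \<open>theta3\<close> at a translated point up to an
  exponential factor, so analyticity and transformation laws can be transferred from
  \<open>theta3\<close>.\<close>

lemma theta2_conv_theta3: "theta2 z \<tau> = unit_exp (\<tau> / 8 + z / 2) * theta3 (z + \<tau> / 2) \<tau>"
proof -
  \<comment> \<open>The functional equation moves the negative half to the argument occurring in
    \<open>theta2_sums\<close>; its constant 1 cancels the \<open>- 1\<close> of
    \<open>theta3_conv_theta_half\<close>.\<close>
  have shift: "theta_half \<tau> (unit_exp (- (z + \<tau> / 2))) =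
      1 + unit_exp (- z) * theta_half \<tau> (unit_exp (\<tau> / 2 - z))"
  proof -
    have a: "qpow \<tau> (1/2) * unit_exp (- (z + \<tau> / 2)) = unit_exp (- z)"
      unfolding qpow_unit_exp unit_exp_add[symmetric] by (simp add: algebra_simps)
    have b: "qpow \<tau> 1 * unit_exp (- (z + \<tau> / 2)) = unit_exp (\<tau> / 2 - z)"
      unfolding qpow_unit_exp unit_exp_add[symmetric] by (simp add: algebra_simps)
    show ?thesis using theta_half_shift[OF \<tau>, of "unit_exp (- (z + \<tau> / 2))"] unfolding a b .
  qed
  have "theta2 z \<tau> = qpow \<tau> (1/8) * (unit_exp (z / 2) * theta_half \<tau> (unit_exp (\<tau> / 2 + z)) +
       unit_exp (- z / 2) * theta_half \<tau> (unit_exp (\<tau> / 2 - z)))"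
    unfolding theta2_def using sums_unique[OF theta2_sums, of z] by simp
  also have "unit_exp (- z / 2) = unit_exp (z / 2) * unit_exp (- z)"
    unfolding unit_exp_add[symmetric] by simp
  also have "qpow \<tau> (1/8) * (unit_exp (z / 2) * theta_half \<tau> (unit_exp (\<tau> / 2 + z)) +
       unit_exp (z / 2) * unit_exp (- z) * theta_half \<tau> (unit_exp (\<tau> / 2 - z))) =
     qpow \<tau> (1/8) * unit_exp (z / 2) * theta3 (z + \<tau> / 2) \<tau>"
    unfolding theta3_conv_theta_half shift by (simp add: algebra_simps)
  also have "qpow \<tau> (1/8) * unit_exp (z / 2) = unit_exp (\<tau> / 8 + z / 2)"
    unfolding qpow_unit_exp unit_exp_add[symmetric] by simp
  finally show ?thesis .
qed

section \<open>Parity, quasi-periodicity and analyticity\<close>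

lemma theta3_minus: "theta3 (- z) \<tau> = theta3 z \<tau>"
  by (simp add: theta3_conv_theta_half)

lemma theta3_add_1: "theta3 (z + 1) \<tau> = theta3 z \<tau>"
proof -
  have "unit_exp (- (z + 1)) = unit_exp (- z)"
    unfolding unit_exp_minus unit_exp_add by simp
  then show ?thesis
    unfolding theta3_conv_theta_half by (simp add: unit_exp_add)
qed

text \<open>\<open>theta_half_shift\<close> is used once in each direction, for the positive and the
  negative half; the constants 1 combine with the \<open>- 1\<close> of
  \<open>theta3_conv_theta_half\<close> to give a homogeneous law.\<close>

lemma theta3_add_tau: "theta3 (z + \<tau>) \<tau> = unit_exp (- (z + \<tau> / 2)) * theta3 z \<tau>"
proof -
  have a: "qpow \<tau> (1/2) * unit_exp z = unit_exp (z + \<tau> / 2)"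
     "qpow \<tau> (1/2) * unit_exp (- (z + \<tau>)) = unit_exp (- (z + \<tau> / 2))"
     "qpow \<tau> 1 * unit_exp z = unit_exp (z + \<tau>)"
     "qpow \<tau> 1 * unit_exp (- (z + \<tau>)) = unit_exp (- z)"
    unfolding qpow_unit_exp unit_exp_add[symmetric]
    by (rule arg_cong[of _ _ unit_exp], simp add: field_simps)+
  have "unit_exp (- (z + \<tau> / 2)) * unit_exp (z + \<tau> / 2) = 1"
    unfolding unit_exp_minus by simp
  with theta_half_shift[OF \<tau>, of "unit_exp z"] theta_half_shift[OF \<tau>, of "unit_exp (- (z + \<tau>))"]
  show ?thesis unfolding theta3_conv_theta_half a by algebra
qed

lemma theta3_holomorphic: "(\<lambda>z. theta3 z \<tau>) holomorphic_on UNIV"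
proof -
  have "(theta_half \<tau> \<circ> (\<lambda>z. unit_exp (c * z))) holomorphic_on UNIV" for c
    by (rule holomorphic_on_compose_gen[OF _ theta_half_holomorphic[OF \<tau>]])
       (auto simp: unit_exp_def intro!: holomorphic_intros)
  from this[of 1] this[of "-1"] show ?thesis
    unfolding theta3_conv_theta_half o_def by (intro holomorphic_intros) auto
qed

text \<open>If \<open>theta3\<close> vanished, \<open>theta_half\<close> at \<open>w\<close> would
  be 1 minus its value at \<open>1/w\<close> for all \<open>w \<noteq> 0\<close>. It would then tend
  to \<open>1 - 1 = 0\<close> at infinity and vanish by Liouville, although its value at 0 is
  1.\<close>

lemma theta3_not_identically_0: "\<exists>z. theta3 z \<tau> \<noteq> 0"
proof (rule ccontr)
  assume "\<not> ?thesis"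
  then have eq: "theta_half \<tau> (unit_exp z) = 1 - theta_half \<tau> (unit_exp (- z))" for z
    using theta3_conv_theta_half[of z] by (simp add: algebra_simps)
  have "\<forall>\<^sub>F w in at_infinity. w \<noteq> (0 :: complex)"
    by (rule eventually_not_equal_at_infinity)
  then have ev: "\<forall>\<^sub>F w in at_infinity. 1 - theta_half \<tau> (inverse w) = theta_half \<tau> w"
  proof eventually_elim
    case (elim w)
    then obtain z where "unit_exp z = w" by (rule unit_exp_surj)
    then show ?case using eq[of z] by (auto simp: unit_exp_minus)
  qed
  have "isCont (theta_half \<tau>) 0"
    using theta_half_holomorphic[OF \<tau>]
    by (meson UNIV_I analytic_at_imp_isCont holomorphic_on_imp_analytic_at open_UNIV)
  then have "((\<lambda>w. theta_half \<tau> (inverse w)) \<longlongrightarrow> theta_half \<tau> 0) at_infinity"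
    by (rule isCont_tendsto_compose) (rule tendsto_inverse_0)
  then have "((\<lambda>w. 1 - theta_half \<tau> (inverse w)) \<longlongrightarrow> 1 - theta_half \<tau> 0) at_infinity"
    by (intro tendsto_intros)
  then have "((\<lambda>w. 1 - theta_half \<tau> (inverse w)) \<longlongrightarrow> 0) at_infinity"
    using theta_half_0[OF \<tau>] by simp
  then have "(theta_half \<tau> \<longlongrightarrow> 0) at_infinity"
    using ev by (rule Lim_transform_eventually)
  from Liouville_weak_0[OF theta_half_holomorphic[OF \<tau>] this, of 0] show False
    using theta_half_0[OF \<tau>] by simp
qed

lemma theta2_minus: "theta2 (- z) \<tau> = theta2 z \<tau>"
  by (simp add: theta2_def)

lemma theta2_add_1: "theta2 (z + 1) \<tau> = - theta2 z \<tau>"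
proof -
  have "unit_exp (\<tau> / 8 + (z + 1) / 2) = unit_exp (\<tau> / 8 + z / 2) * unit_exp (1 / 2)"
    unfolding unit_exp_add[symmetric] by (simp add: add_divide_distrib add_ac)
  moreover have "theta3 (z + 1 + \<tau> / 2) \<tau> = theta3 (z + \<tau> / 2) \<tau>"
    using theta3_add_1[of "z + \<tau> / 2"] by (simp add: add_ac)
  ultimately show ?thesis by (simp add: theta2_conv_theta3)
qed

lemma theta2_add_tau: "theta2 (z + \<tau>) \<tau> = unit_exp (- (z + \<tau> / 2)) * theta2 z \<tau>"
proof -
  have "unit_exp (\<tau> / 8 + (z + \<tau>) / 2) * unit_exp (- (z + \<tau> / 2 + \<tau> / 2)) =
      unit_exp (- (z + \<tau> / 2)) * unit_exp (\<tau> / 8 + z / 2)"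
    unfolding unit_exp_add[symmetric] by (simp add: field_simps)
  moreover have "theta3 (z + \<tau> + \<tau> / 2) \<tau> = unit_exp (- (z + \<tau> / 2 + \<tau> / 2)) * theta3 (z + \<tau> / 2) \<tau>"
    using theta3_add_tau[of "z + \<tau> / 2"] by (simp add: add_ac)
  ultimately show ?thesis by (simp add: theta2_conv_theta3)
qed

lemma unit_exp_minus_add_half: "unit_exp (- (z + 1/2)) = - unit_exp (- z)"
  unfolding unit_exp_minus unit_exp_add by simp

lemma theta4_add_1: "theta4 (z + 1) \<tau> = theta4 z \<tau>"
  using theta3_add_1[of "z + 1/2"] by (simp add: theta4_conv_theta3 add_ac)

lemma theta4_add_tau: "theta4 (z + \<tau>) \<tau> = - unit_exp (- (z + \<tau> / 2)) * theta4 z \<tau>"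
  using theta3_add_tau[of "z + 1/2"] unit_exp_minus_add_half[of "z + \<tau> / 2"]
  by (simp add: theta4_conv_theta3 add_ac)

lemma theta1_add_1: "theta1 (z + 1) \<tau> = - theta1 z \<tau>"
  using theta2_add_1[of "z + 1/2"] by (simp add: theta1_conv_theta2 add_ac)

lemma theta1_add_tau: "theta1 (z + \<tau>) \<tau> = - unit_exp (- (z + \<tau> / 2)) * theta1 z \<tau>"
  using theta2_add_tau[of "z + 1/2"] unit_exp_minus_add_half[of "z + \<tau> / 2"]
  by (simp add: theta1_conv_theta2 add_ac)

lemma theta1_add_half: "theta1 (z + 1/2) \<tau> = theta2 z \<tau>"
  using theta2_add_1[of z] by (simp add: theta1_conv_theta2 add_ac)

lemma theta1_minus: "theta1 (- z) \<tau> = - theta1 z \<tau>"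
proof -
  have "theta2 (1/2 - z) \<tau> = theta2 (z - 1/2) \<tau>"
    using theta2_minus[of "z - 1/2"] by simp
  also have "\<dots> = - theta2 (z + 1/2) \<tau>"
    using theta2_add_1[of "z - 1/2"] by (simp add: add_ac)
  finally show ?thesis by (simp add: theta1_conv_theta2)
qed

lemma theta4_minus: "theta4 (- z) \<tau> = theta4 z \<tau>"
proof -
  have "theta3 (1/2 - z) \<tau> = theta3 (z - 1/2) \<tau>"
    using theta3_minus[of "z - 1/2"] by simp
  also have "\<dots> = theta3 (z + 1/2) \<tau>"
    using theta3_add_1[of "z - 1/2"] by (simp add: add_ac)
  finally show ?thesis by (simp add: theta4_conv_theta3)
qed

lemma theta3_analytic: "(\<lambda>z. theta3 z \<tau>) analytic_on {z}"
  using theta3_holomorphic by (simp add: holomorphic_on_imp_analytic_at)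

lemma theta3_shift_analytic: "(\<lambda>z. theta3 (z + c) \<tau>) analytic_on {z}"
proof -
  have "((\<lambda>z. theta3 z \<tau>) \<circ> (\<lambda>z. z + c)) analytic_on {z}"
    by (rule analytic_on_compose) (auto intro!: analytic_intros theta3_analytic)
  then show ?thesis by (simp add: o_def)
qed

lemma theta4_analytic: "(\<lambda>z. theta4 z \<tau>) analytic_on {z}"
  unfolding theta4_conv_theta3 by (rule theta3_shift_analytic)

lemma theta2_analytic: "(\<lambda>z. theta2 z \<tau>) analytic_on {z}"
  unfolding theta2_conv_theta3 by (intro analytic_intros theta3_shift_analytic) auto

lemma theta1_analytic: "(\<lambda>z. theta1 z \<tau>) analytic_on {z}"
  unfolding theta1_conv_theta2 theta2_conv_theta3 add.assoc
  by (intro analytic_intros theta3_shift_analytic) auto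

section \<open>The product form of \<open>theta1\<close>\<close>

text \<open>Up to a constant factor this is the triple product of \<open>\<theta>\<^sub>1\<close>; its zeros can be read off.\<close>

definition theta1_product :: "complex \<Rightarrow> complex" where
  "theta1_product z = sin (of_real pi * z) * (euler_fun \<tau> (unit_exp z) * euler_fun \<tau> (unit_exp (- z)))"

text \<open>A zero has the form \<open>z = k - n \<tau>\<close> with integer \<open>k\<close> and
  \<open>n > 0\<close>; positivity of \<open>n\<close> excludes \<open>z = 0\<close>.\<close>

lemma euler_fun_unit_exp_eq_0:
  assumes "euler_fun \<tau> (unit_exp z) = 0"
  shows "z \<in> lattice \<tau>" "z \<noteq> 0"
proof -
  obtain n :: nat where n: "n > 0" "qpow \<tau> (real n) * unit_exp z = 1"
    using euler_fun_eq_0[OF \<tau> assms] by blast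
  then have "unit_exp (of_nat n * \<tau> + z) = 1"
    by (simp add: qpow_unit_exp unit_exp_add)
  then obtain k where k: "of_nat n * \<tau> + z = of_int k"
    unfolding unit_exp_eq_1_iff by (auto elim: Ints_cases)
  then have "z = of_int (- int n) * \<tau> + of_int k" by (simp add: algebra_simps)
  then show "z \<in> lattice \<tau>" by (rule latticeI)
  show "z \<noteq> 0" using n qpow_neq_1[OF \<tau>, of n] by auto
qed

lemma lattice_minus: "- z \<in> lattice \<tau> \<longleftrightarrow> z \<in> lattice \<tau>"
proof -
  have "- z \<in> lattice \<tau>" if "z \<in> lattice \<tau>" for z
  proof -
    from that obtain m n where "z = of_int m * \<tau> + of_int n" by (rule latticeE)
    then have "- z = of_int (- m) * \<tau> + of_int (- n)" by simp
    then show ?thesis by (rule latticeI)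
  qed
  from this[of z] this[of "- z"] show ?thesis by auto
qed

lemma theta1_product_eq_0: "theta1_product z = 0 \<Longrightarrow> z \<in> lattice \<tau>"
proof -
  assume "theta1_product z = 0"
  then consider "sin (of_real pi * z) = 0" | "euler_fun \<tau> (unit_exp z) = 0" | "euler_fun \<tau> (unit_exp (- z)) = 0"
    by (auto simp: theta1_product_def)
  then show ?thesis
  proof cases
    case 1
    then obtain k :: int where "of_real pi * z = of_real (of_int k * pi)"
      by (auto simp: sin_eq_0)
    then have "z = of_int 0 * \<tau> + of_int k" by simp
    then show ?thesis by (rule latticeI)
  next
    case 2
    then show ?thesis by (rule euler_fun_unit_exp_eq_0)
  next
    case 3
    then show ?thesis using euler_fun_unit_exp_eq_0[of "- z"] lattice_minus by blast
  qed
qed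

lemma theta1_product_add_1: "theta1_product (z + 1) = - theta1_product z"
proof -
  have "unit_exp (- (z + 1)) = unit_exp (- z)"
    unfolding unit_exp_minus unit_exp_add by simp
  moreover have "sin (of_real pi * (z + 1)) = - sin (of_real pi * z)"
    by (simp add: ring_distribs sin_add)
  ultimately show ?thesis by (simp add: theta1_product_def unit_exp_add)
qed

text \<open>The shift removes a linear factor from \<open>euler_fun\<close> at
  \<open>unit_exp z\<close> and adds one at \<open>unit_exp (- z)\<close>; together with the change
  of the sine this gives the multiplier of \<open>theta1\<close>.\<close>

lemma theta1_product_add_tau:
  "theta1_product (z + \<tau>) = - unit_exp (- (z + \<tau> / 2)) * theta1_product z"
proof -
  have q: "qpow \<tau> 1 * unit_exp z = unit_exp (z + \<tau>)"
    "qpow \<tau> 1 * unit_exp (- (z + \<tau>)) = unit_exp (- z)"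
    unfolding qpow_unit_exp unit_exp_add[symmetric] by (simp_all add: add_ac)
  have e: "euler_fun \<tau> (unit_exp z) = (1 - unit_exp (z + \<tau>)) * euler_fun \<tau> (unit_exp (z + \<tau>))"
    "euler_fun \<tau> (unit_exp (- (z + \<tau>))) = (1 - unit_exp (- z)) * euler_fun \<tau> (unit_exp (- z))"
    using euler_fun_shift[OF \<tau>, of "unit_exp z"] euler_fun_shift[OF \<tau>, of "unit_exp (- (z + \<tau>))"]
    unfolding q .
  have "unit_exp (- (z + \<tau>) / 2) * unit_exp (- z) = unit_exp (- (z + \<tau> / 2)) * unit_exp (- z / 2)"
    unfolding unit_exp_add[symmetric] by (simp add: field_simps)
  moreover have "unit_exp (- (z + \<tau>) / 2) = unit_exp (- (z + \<tau> / 2)) * unit_exp (- z / 2) * unit_exp z"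
    unfolding unit_exp_add[symmetric] by (simp add: field_simps)
  ultimately have "unit_exp (- (z + \<tau>) / 2) * (1 - unit_exp (- z)) =
      - unit_exp (- (z + \<tau> / 2)) * (unit_exp (- z / 2) * (1 - unit_exp z))"
    by (simp add: algebra_simps)
  then show ?thesis
    unfolding theta1_product_def sin_pi_unit_exp e by algebra
qed

lemma theta1_product_analytic: "theta1_product analytic_on {z}"
proof -
  have "(euler_fun \<tau> \<circ> (\<lambda>z. unit_exp (c * z))) analytic_on {z}" for c
    by (rule analytic_on_compose)
       (auto intro!: analytic_intros holomorphic_on_imp_analytic_at[OF euler_fun_holomorphic[OF \<tau>]])
  from this[of 1] this[of "-1"] show ?thesis
    unfolding theta1_product_def[abs_def] o_def by (auto intro!: analytic_intros)
qed

text \<open>The sine has a simple zero at 0, where the Euler factors do not vanish.\<close>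

lemma theta1_product_deriv_0: "theta1_product 0 = 0" "deriv theta1_product 0 \<noteq> 0"
proof -
  let ?v = "\<lambda>z. euler_fun \<tau> (unit_exp z) * euler_fun \<tau> (unit_exp (- z))"
  have "(euler_fun \<tau> \<circ> (\<lambda>z. unit_exp (c * z))) analytic_on {0}" for c
    by (rule analytic_on_compose)
       (auto intro!: analytic_intros holomorphic_on_imp_analytic_at[OF euler_fun_holomorphic[OF \<tau>]])
  from this[of 1] this[of "-1"] have "?v analytic_on {0}"
    unfolding o_def by (auto intro!: analytic_intros)
  then have v: "(?v has_field_derivative deriv ?v 0) (at 0)"
    by (meson analytic_on_imp_differentiable_at field_differentiable_derivI singletonI)
  have "(theta1_product has_field_derivative of_real pi * ?v 0) (at 0)"
    unfolding theta1_product_def[abs_def]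
    by (rule DERIV_mult'[THEN DERIV_cong, OF _ v]) (auto intro!: derivative_eq_intros)
  then have "deriv theta1_product 0 = of_real pi * ?v 0" by (rule DERIV_imp_deriv)
  then show "deriv theta1_product 0 \<noteq> 0"
    using euler_fun_unit_exp_eq_0(2)[of 0] by auto
  show "theta1_product 0 = 0" by (simp add: theta1_product_def)
qed

end

section \<open>Zeros and quotients of theta functions\<close>

definition diff_quot :: "(complex \<Rightarrow> complex) \<Rightarrow> complex \<Rightarrow> complex \<Rightarrow> complex" where
  "diff_quot f a z = (if z = a then deriv f a else (f z - f a) / (z - a))"

lemma diff_quot_self [simp]: "diff_quot f a a = deriv f a"
  by (simp add: diff_quot_def)

lemma analytic_diff_quot: "f analytic_on {a} \<Longrightarrow> diff_quot f a analytic_on {a}"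
  unfolding diff_quot_def[abs_def] by (rule analytic_difference_quotient)

lemma diff_quot_eq: "f z = f a + (z - a) * diff_quot f a z"
  by (simp add: diff_quot_def)

lemma shift_invariant_int:
  fixes P :: "complex \<Rightarrow> bool"
  assumes "\<And>z. P (z + \<omega>) = P z"
  shows "P (z + of_int m * \<omega>) = P z"
proof (induction m rule: int_induct[where k = 0])
  case (step1 i)
  then show ?case using assms[of "z + of_int i * \<omega>"] by (simp add: algebra_simps)
next
  case (step2 i)
  then show ?case using assms[of "z + of_int (i - 1) * \<omega>"] by (simp add: algebra_simps)
qed simp

text \<open>Phrased for predicates so that it transports vanishing as well as removability along the
  lattice.\<close>

lemma lattice_invariant:
  fixes P :: "complex \<Rightarrow> bool"
  assumes "\<And>z. P (z + 1) = P z" "\<And>z. P (z + \<tau>) = P z" "z - w \<in> lattice \<tau>"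
  shows "P z = P w"
proof -
  obtain m n where "z - w = of_int m * \<tau> + of_int n"
    using assms(3) by (rule latticeE)
  then have "z = (w + of_int n * 1) + of_int m * \<tau>"
    by (simp add: algebra_simps)
  then show ?thesis
    using shift_invariant_int[of P 1, OF assms(1)] shift_invariant_int[of P \<tau>, OF assms(2)] by metis
qed

lemma removable_multiplier:
  assumes "\<And>z. f (z + \<omega>) = \<epsilon> * f z" "\<epsilon> \<noteq> 0"
  shows "removable f (z + \<omega>) \<longleftrightarrow> removable f z"
proof
  assume "removable f (z + \<omega>)"
  then have "removable (\<lambda>w. f (w + \<omega>)) z" by (rule removable_shift)
  then have "removable (\<lambda>w. inverse \<epsilon> * f (w + \<omega>)) z"
    by (intro removable_mult removable_const)
  then show "removable f z" using assms by (simp add: field_simps)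
next
  assume "removable f z"
  then have "removable (\<lambda>w. f (w + - \<omega>)) (z + \<omega>)" by (intro removable_shift) simp
  then have "removable (\<lambda>w. \<epsilon> * f (w + - \<omega>)) (z + \<omega>)"
    by (intro removable_mult removable_const)
  moreover have "\<epsilon> * f (w + - \<omega>) = f w" for w
    using assms(1)[of "w + - \<omega>"] by simp
  ultimately show "removable f (z + \<omega>)" by simp
qed

lemma analytic_eventually_const:
  assumes "h analytic_on {a}" "\<forall>\<^sub>F z in at a. h z = C"
  shows "h a = C"
proof -
  have "h \<midarrow>a\<rightarrow> h a"
    using analytic_at_imp_isCont[OF assms(1)] by (simp add: isCont_def)
  moreover have "h \<midarrow>a\<rightarrow> C"
    using assms(2) by (rule tendsto_eventually)
  ultimately show ?thesis by (rule LIM_unique)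
qed

lemma lattice_Int_reals:
  assumes "Im \<tau> \<noteq> 0" "of_real s * \<tau> + of_real t \<in> lattice \<tau>"
  shows "s \<in> \<int>" "t \<in> \<int>"
proof -
  obtain m n where "of_real s * \<tau> + of_real t = of_int m * \<tau> + of_int n"
    using assms(2) by (rule latticeE)
  then have "of_real s * \<tau> + of_real t = of_real (of_int m) * \<tau> + of_real (of_int n)"
    by simp
  from lattice_coordinates_unique[OF assms(1) this] show "s \<in> \<int>" "t \<in> \<int>" by auto
qed

lemma half_not_Ints: "(1/2 :: real) \<notin> \<int>" "(- 1/2 :: real) \<notin> \<int>"
proof -
  show "(1/2 :: real) \<notin> \<int>" using Ints_nonzero_abs_ge1[of "1/2 :: real"] by auto
  show "(- 1/2 :: real) \<notin> \<int>" using Ints_nonzero_abs_ge1[of "- 1/2 :: real"] by auto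
qed

section \<open>Laurent expansion of odd functions at a simple pole\<close>

lemma deriv_even_0:
  assumes "f analytic_on {0}" "\<And>z. f (- z) = f z"
  shows "deriv f 0 = 0"
proof -
  have d: "(f has_field_derivative deriv f 0) (at 0)"
    using assms(1) by (meson analytic_on_imp_differentiable_at field_differentiable_derivI singletonI)
  have "((\<lambda>z. f (- z)) has_field_derivative deriv f 0 * (- 1)) (at 0)"
    by (rule DERIV_chain'[where f = uminus and g = f]) (auto intro!: derivative_eq_intros d)
  then have "(f has_field_derivative - deriv f 0) (at 0)" by (simp add: assms(2))
  from DERIV_unique[OF d this] show ?thesis by simp
qed

text \<open>Residue 1 and vanishing constant term are built in; \<open>m 0\<close> is the Laurent
  coefficient of \<open>z\<close>.\<close>

definition simple_pole_form :: "(complex \<Rightarrow> complex) \<Rightarrow> (complex \<Rightarrow> complex) \<Rightarrow> bool" where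
  "simple_pole_form g m \<longleftrightarrow> m analytic_on {0} \<and> (\<forall>\<^sub>F z in at 0. g z = 1 / z + z * m z)"

text \<open>Multiplied by \<open>z\<close>, the quotient becomes an even analytic function
  \<open>K\<close> with \<open>K 0 = 1\<close>, whose derivative at 0 vanishes; two successive
  difference quotients remove these two Taylor coefficients.\<close>

lemma even_odd_quotient_pole:
  assumes N: "N analytic_on {0}" "\<And>z. N (- z) = N z" "N 0 \<noteq> 0"
    and D: "D analytic_on {0}" "\<And>z. D (- z) = - D z" "deriv D 0 \<noteq> 0"
  obtains m where "simple_pole_form (\<lambda>z. deriv D 0 / N 0 * (N z / D z)) m"
proof -
  define K where "K z = deriv D 0 / N 0 * (N z / diff_quot D 0 z)" for z
  have D0: "D 0 = 0" using D(2)[of 0] by simp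
  have K: "K analytic_on {0}"
    unfolding K_def[abs_def] by (intro analytic_intros N analytic_diff_quot D) (use D in auto)
  have even: "K (- z) = K z" for z
    by (simp add: K_def diff_quot_def N(2) D(2) D0)
  have K0: "K 0 = 1" using N(3) D(3) by (simp add: K_def)
  define k1 where "k1 = diff_quot K 0"
  have k1: "k1 analytic_on {0}" unfolding k1_def by (rule analytic_diff_quot[OF K])
  have k10: "k1 0 = 0" using deriv_even_0[OF K even] by (simp add: k1_def)
  have "deriv D 0 / N 0 * (N z / D z) = 1 / z + z * diff_quot k1 0 z" if "z \<noteq> 0" for z
  proof -
    have "deriv D 0 / N 0 * (N z / D z) = K z / z"
      using that diff_quot_eq[of D z 0] by (simp add: K_def D0)
    also have "K z = 1 + z * k1 z"
      using diff_quot_eq[of K z 0] K0 by (simp add: k1_def)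
    also have "k1 z = z * diff_quot k1 0 z"
      using diff_quot_eq[of k1 z 0] k10 by simp
    finally show ?thesis using that by (simp add: field_simps)
  qed
  then have "simple_pole_form (\<lambda>z. deriv D 0 / N 0 * (N z / D z)) (diff_quot k1 0)"
    unfolding simple_pole_form_def
    by (auto simp: eventually_at intro!: analytic_diff_quot k1 exI[of _ 1])
  then show thesis by (rule that)
qed

lemma simple_pole_form_deriv:
  assumes "simple_pole_form g m"
  shows "\<forall>\<^sub>F z in at 0. deriv g z = - 1 / z\<^sup>2 + m z + z * deriv m z"
proof -
  have m: "m analytic_on {0}" and g: "\<forall>\<^sub>F z in nhds 0. z \<noteq> 0 \<longrightarrow> g z = 1 / z + z * m z"
    using assms by (auto simp: simple_pole_form_def eventually_at_filter)
  have ana: "\<forall>\<^sub>F w in nhds 0. m analytic_on {w}"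
    using m by (metis analytic_at eventually_nhds holomorphic_on_imp_analytic_at)
  \<comment> \<open>Differentiating at \<open>w\<close> requires the expansion in a whole
    neighbourhood of \<open>w\<close>.\<close>
  from g have "\<forall>\<^sub>F w in nhds 0. \<forall>\<^sub>F z in nhds w. z \<noteq> 0 \<longrightarrow> g z = 1 / z + z * m z"
    by (simp add: eventually_eventually)
  with ana have "\<forall>\<^sub>F z in nhds 0. z \<noteq> 0 \<longrightarrow> deriv g z = - 1 / z\<^sup>2 + m z + z * deriv m z"
  proof eventually_elim
    case (elim w)
    show ?case
    proof
      assume w: "w \<noteq> 0"
      then have "\<forall>\<^sub>F z in nhds w. z \<noteq> 0" by (rule t1_space_nhds)
      with elim(2) have ev: "\<forall>\<^sub>F z in nhds w. g z = 1 / z + z * m z"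
        by eventually_elim auto
      have "(m has_field_derivative deriv m w) (at w)"
        using elim(1) by (meson analytic_on_imp_differentiable_at field_differentiable_derivI singletonI)
      then have "((\<lambda>z. 1 / z + z * m z) has_field_derivative - 1 / w\<^sup>2 + m w + w * deriv m w) (at w)"
        using w by (auto intro!: derivative_eq_intros simp: power2_eq_square)
      from DERIV_imp_deriv[OF this] deriv_cong_ev[OF ev refl]
      show "deriv g w = - 1 / w\<^sup>2 + m w + w * deriv m w" by simp
    qed
  qed
  then show ?thesis by (simp add: eventually_at_filter)
qed

context
  fixes \<tau> :: complex
  assumes \<tau>: "Im \<tau> > 0"
begin

text \<open>One local extension \<open>h\<close> at 0 suffices, since the multipliers carry
  removability to every lattice point. The constant is then read off as \<open>h 0\<close>.\<close>

lemma liouville_lattice: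
  assumes 1: "\<And>z. f (z + 1) = \<epsilon>1 * f z" "norm \<epsilon>1 = 1"
    and 2: "\<And>z. f (z + \<tau>) = \<epsilon>2 * f z" "norm \<epsilon>2 = 1"
    and ana: "\<And>z. z \<notin> lattice \<tau> \<Longrightarrow> f analytic_on {z}"
    and h: "h analytic_on {0}" "\<forall>\<^sub>F z in at 0. f z = h z"
  obtains "\<And>z. z \<notin> lattice \<tau> \<Longrightarrow> f z = h 0" "h 0 = \<epsilon>1 * h 0" "h 0 = \<epsilon>2 * h 0"
proof -
  have ne: "\<epsilon>1 \<noteq> 0" "\<epsilon>2 \<noteq> 0" using 1(2) 2(2) by auto
  have "removable f z" for z
  proof (cases "z \<in> lattice \<tau>")
    case True
    have "removable f z = removable f 0"
      by (rule lattice_invariant[where \<tau> = \<tau>])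
         (use removable_multiplier[of f 1, OF 1(1) ne(1)] removable_multiplier[of f \<tau>, OF 2(1) ne(2)] True in auto)
    then show ?thesis using h by (auto simp: removable_def)
  next
    case False
    then show ?thesis by (intro removable_analytic ana)
  qed
  then obtain C where C: "\<And>z. \<forall>\<^sub>F w in at z. f w = C" "C = \<epsilon>1 * C" "C = \<epsilon>2 * C"
    using liouville_quasiperiodic[OF \<tau> 1 2] by metis
  from h(2) C(1)[of 0] have "\<forall>\<^sub>F z in at 0. h z = C" by eventually_elim auto
  with h(1) have "h 0 = C" by (rule analytic_eventually_const)
  moreover have "f z = C" if "z \<notin> lattice \<tau>" for z
    using ana[OF that] C(1) by (rule analytic_eventually_const)
  ultimately show thesis using C that by simp
qed

section \<open>Zeros of \<open>theta1\<close> and nonvanishing theta constants\<close>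

lemma theta1_0: "theta1 0 \<tau> = 0"
  using theta1_minus[OF \<tau>, of 0] by simp

lemma theta1_lattice: "z \<in> lattice \<tau> \<Longrightarrow> theta1 z \<tau> = 0"
proof -
  assume "z \<in> lattice \<tau>"
  then have "z - 0 \<in> lattice \<tau>" by simp
  then have "(theta1 z \<tau> = 0) = (theta1 0 \<tau> = 0)"
    by (rule lattice_invariant[where P = "\<lambda>z. theta1 z \<tau> = 0", rotated 2])
       (simp_all add: theta1_add_1[OF \<tau>] theta1_add_tau[OF \<tau>])
  then show ?thesis using theta1_0 by simp
qed

lemma theta1_product_lattice: "z \<in> lattice \<tau> \<Longrightarrow> theta1_product \<tau> z = 0"
proof -
  assume "z \<in> lattice \<tau>"
  then have "z - 0 \<in> lattice \<tau>" by simp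
  then have "(theta1_product \<tau> z = 0) = (theta1_product \<tau> 0 = 0)"
    by (rule lattice_invariant[where P = "\<lambda>z. theta1_product \<tau> z = 0", rotated 2])
       (simp_all add: theta1_product_add_1[OF \<tau>] theta1_product_add_tau[OF \<tau>])
  then show ?thesis using theta1_product_deriv_0[OF \<tau>] by simp
qed

lemma theta1_conv_theta3:
  "theta1 z \<tau> = - unit_exp (\<tau> / 8 + (z + 1/2) / 2) * theta3 (z + 1/2 + \<tau> / 2) \<tau>"
  by (simp add: theta1_conv_theta2[OF \<tau>] theta2_conv_theta3[OF \<tau>])

text \<open>Both functions have the same multipliers, so their quotient is doubly periodic. Its
  singularity at 0 is removable because the product has a simple zero there and
  \<open>theta1\<close> vanishes too. The constant is nonzero because \<open>theta1\<close> is a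
  translate of \<open>theta3\<close> up to a nonvanishing factor.\<close>

lemma theta1_eq_product:
  obtains C where "C \<noteq> 0" "\<And>z. theta1 z \<tau> = C * theta1_product \<tau> z"
proof -
  let ?t = "\<lambda>z. theta1 z \<tau>" and ?s = "theta1_product \<tau>"
  let ?f = "\<lambda>z. ?t z / ?s z" and ?h = "\<lambda>z. diff_quot ?t 0 z / diff_quot ?s 0 z"
  have s0: "?s 0 = 0" "deriv ?s 0 \<noteq> 0" using theta1_product_deriv_0[OF \<tau>] by auto
  obtain C where C: "\<And>z. z \<notin> lattice \<tau> \<Longrightarrow> ?f z = C"
  proof (rule liouville_lattice[of ?f 1 1 ?h])
    show "?f (z + 1) = 1 * ?f z" for z
      by (simp add: theta1_add_1[OF \<tau>] theta1_product_add_1[OF \<tau>])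
    show "?f (z + \<tau>) = 1 * ?f z" for z
      by (simp add: theta1_add_tau[OF \<tau>] theta1_product_add_tau[OF \<tau>])
    show "?f analytic_on {z}" if "z \<notin> lattice \<tau>" for z
      using that theta1_product_eq_0[OF \<tau>]
      by (auto intro!: analytic_intros theta1_analytic[OF \<tau>] theta1_product_analytic[OF \<tau>])
    show "?h analytic_on {0}"
      using s0 by (auto intro!: analytic_intros analytic_diff_quot theta1_analytic[OF \<tau>] theta1_product_analytic[OF \<tau>])
    show "\<forall>\<^sub>F z in at 0. ?f z = ?h z"
      using s0 theta1_0 by (auto simp: eventually_at diff_quot_def intro!: exI[of _ 1])
  qed auto
  have eq: "theta1 z \<tau> = C * theta1_product \<tau> z" for z
  proof (cases "z \<in> lattice \<tau>")
    case True
    then show ?thesis by (simp add: theta1_lattice theta1_product_lattice)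
  next
    case False
    then show ?thesis using C[of z] theta1_product_eq_0[OF \<tau>, of z] by (auto simp: field_simps)
  qed
  moreover have "C \<noteq> 0"
  proof
    assume "C = 0"
    then have "theta3 (z + 1/2 + \<tau> / 2) \<tau> = 0" for z
      using eq[of z] theta1_conv_theta3[of z] by simp
    from this[of "z - 1/2 - \<tau> / 2" for z] show False
      using theta3_not_identically_0[OF \<tau>] by auto
  qed
  ultimately show thesis using that by blast
qed

lemma theta1_eq_0_iff: "theta1 z \<tau> = 0 \<longleftrightarrow> z \<in> lattice \<tau>"
proof -
  obtain C where "C \<noteq> 0" "\<And>z. theta1 z \<tau> = C * theta1_product \<tau> z"
    by (rule theta1_eq_product) blast
  then show ?thesis using theta1_product_eq_0[OF \<tau>, of z] theta1_lattice[of z] by auto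
qed

lemma deriv_theta1_0: "deriv (\<lambda>z. theta1 z \<tau>) 0 \<noteq> 0"
proof -
  obtain C where C: "C \<noteq> 0" "\<And>z. theta1 z \<tau> = C * theta1_product \<tau> z"
    by (rule theta1_eq_product) blast
  have "theta1_product \<tau> field_differentiable at 0"
    using theta1_product_analytic[OF \<tau>] by (meson analytic_on_imp_differentiable_at singletonI)
  then have "deriv (\<lambda>z. theta1 z \<tau>) 0 = C * deriv (theta1_product \<tau>) 0"
    unfolding C(2) by (rule deriv_cmult)
  then show ?thesis using C theta1_product_deriv_0[OF \<tau>] by simp
qed

lemma lattice_add:
  "z + 1 \<in> lattice \<tau> \<longleftrightarrow> z \<in> lattice \<tau>" "z + \<tau> \<in> lattice \<tau> \<longleftrightarrow> z \<in> lattice \<tau>"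
  unfolding theta1_eq_0_iff[symmetric] by (simp_all add: theta1_add_1[OF \<tau>] theta1_add_tau[OF \<tau>])

lemma eventually_nhds_not_lattice:
  assumes "z \<notin> lattice \<tau>"
  shows "\<forall>\<^sub>F w in nhds z. w \<notin> lattice \<tau>"
proof -
  have "isCont (\<lambda>z. theta1 z \<tau>) z" by (rule analytic_at_imp_isCont[OF theta1_analytic[OF \<tau>]])
  then have "(\<lambda>z. theta1 z \<tau>) \<midarrow>z\<rightarrow> theta1 z \<tau>" by (simp add: isCont_def)
  then have "\<forall>\<^sub>F w in at z. theta1 w \<tau> \<noteq> 0"
    by (rule tendsto_imp_eventually_ne) (use assms theta1_eq_0_iff in auto)
  with assms show ?thesis by (simp add: theta1_eq_0_iff eventually_nhds_conv_at)
qed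

text \<open>\<open>theta1\<close> has an isolated zero at 0, its derivative there being
  nonzero.\<close>

lemma eventually_at_0_not_lattice: "\<forall>\<^sub>F z in at 0. z \<notin> lattice \<tau>"
proof -
  let ?d = "diff_quot (\<lambda>z. theta1 z \<tau>) 0"
  have "isCont ?d 0" by (intro analytic_at_imp_isCont analytic_diff_quot theta1_analytic[OF \<tau>])
  then have "?d \<midarrow>0\<rightarrow> ?d 0" by (simp add: isCont_def)
  then have "\<forall>\<^sub>F z in at 0. ?d z \<noteq> 0"
    by (rule tendsto_imp_eventually_ne) (simp add: deriv_theta1_0)
  then show ?thesis
    unfolding eventually_at_filter
  proof eventually_elim
    case (elim z)
    then show ?case using diff_quot_eq[of "\<lambda>z. theta1 z \<tau>" z 0] theta1_0 by (simp add: theta1_eq_0_iff[symmetric])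
  qed
qed

text \<open>At \<open>1/2\<close>, \<open>- 1/2 - \<tau> / 2\<close> and \<open>- \<tau> / 2\<close>
  the function \<open>theta1\<close> reduces, up to nonzero factors, to the values of
  \<open>theta2\<close>, \<open>theta3\<close> and \<open>theta4\<close> at 0. The point
  \<open>1/2 + \<tau> / 2\<close> is a zero of \<open>theta3\<close> and serves for evaluation
  later.\<close>

lemma half_periods_not_lattice:
  "1/2 \<notin> lattice \<tau>" "- \<tau> / 2 \<notin> lattice \<tau>" "1/2 + \<tau> / 2 \<notin> lattice \<tau>" "- 1/2 - \<tau> / 2 \<notin> lattice \<tau>"
proof -
  have "Im \<tau> \<noteq> 0" using \<tau> by simp
  note L = lattice_Int_reals[OF this]
  show "1/2 \<notin> lattice \<tau>" using L(2)[of 0 "1/2"] half_not_Ints by auto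
  show "- \<tau> / 2 \<notin> lattice \<tau>" using L(1)[of "- 1/2" 0] half_not_Ints by auto
  show *: "1/2 + \<tau> / 2 \<notin> lattice \<tau>" using L(1)[of "1/2" "1/2"] half_not_Ints by (auto simp: add_ac)
  show "- 1/2 - \<tau> / 2 \<notin> lattice \<tau>"
    using * lattice_minus[OF \<tau>, of "1/2 + \<tau> / 2"] by simp
qed

lemma theta2_0: "theta2 0 \<tau> \<noteq> 0"
  using theta1_eq_0_iff[of "1/2"] theta1_add_half[OF \<tau>, of 0] half_periods_not_lattice by simp

lemma theta3_0: "theta3 0 \<tau> \<noteq> 0"
  using theta1_eq_0_iff[of "- 1/2 - \<tau> / 2"] theta1_conv_theta3[of "- 1/2 - \<tau> / 2"] half_periods_not_lattice
  by simp

lemma theta4_0: "theta4 0 \<tau> \<noteq> 0"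
  using theta1_eq_0_iff[of "- \<tau> / 2"] theta1_conv_theta3[of "- \<tau> / 2"] half_periods_not_lattice
  by (simp add: theta4_conv_theta3)

lemma theta_at_half:
  "theta1 (1/2) \<tau> = theta2 0 \<tau>" "theta2 (1/2) \<tau> = 0"
  "theta3 (1/2) \<tau> = theta4 0 \<tau>" "theta4 (1/2) \<tau> = theta3 0 \<tau>"
  using theta1_add_half[OF \<tau>, of 0] theta1_conv_theta2[OF \<tau>, of 0] theta1_0 theta3_add_1[OF \<tau>, of 0]
  by (simp_all add: theta4_conv_theta3)

lemma theta_at_half_sum:
  "theta1 (1/2 + \<tau> / 2) \<tau> = unit_exp (- \<tau> / 8) * theta3 0 \<tau>"
  "theta3 (1/2 + \<tau> / 2) \<tau> = 0"
  "theta4 (1/2 + \<tau> / 2) \<tau> = unit_exp (- \<tau> / 8) * theta2 0 \<tau>"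
proof -
  have "theta1 (1/2 + \<tau> / 2) \<tau> = theta2 (\<tau> / 2) \<tau>"
    using theta1_add_half[OF \<tau>, of "\<tau> / 2"] by (simp add: add_ac)
  also have "\<dots> = unit_exp (\<tau> / 8 + \<tau> / 2 / 2) * (unit_exp (- (\<tau> / 2)) * theta3 0 \<tau>)"
    using theta3_add_tau[OF \<tau>, of 0] by (simp add: theta2_conv_theta3[OF \<tau>])
  also have "\<dots> = unit_exp (\<tau> / 8 + \<tau> / 2 / 2 + - (\<tau> / 2)) * theta3 0 \<tau>"
    unfolding unit_exp_add by simp
  also have "\<tau> / 8 + \<tau> / 2 / 2 + - (\<tau> / 2) = - \<tau> / 8" by simp
  finally show "theta1 (1/2 + \<tau> / 2) \<tau> = unit_exp (- \<tau> / 8) * theta3 0 \<tau>" .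
  show "theta3 (1/2 + \<tau> / 2) \<tau> = 0"
    using theta1_conv_theta3[of 0] theta1_0 by simp
  have "theta4 (1/2 + \<tau> / 2) \<tau> = theta3 (\<tau> / 2 + 1) \<tau>"
    by (simp add: theta4_conv_theta3 add_ac)
  also have "\<dots> = theta3 (\<tau> / 2) \<tau>" by (rule theta3_add_1[OF \<tau>])
  also have "\<dots> = unit_exp (- \<tau> / 8) * theta2 0 \<tau>"
    by (simp add: theta2_conv_theta3[OF \<tau>] unit_exp_minus)
  finally show "theta4 (1/2 + \<tau> / 2) \<tau> = unit_exp (- \<tau> / 8) * theta2 0 \<tau>" .
qed

section \<open>The quotients by \<open>theta1\<close> and the relations between them\<close>

text \<open>At lattice points the value is \<open>0\<close> because \<open>x / 0 = 0\<close>, so the multiplier laws hold everywhere.\<close>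

definition theta_quotient :: "(complex \<Rightarrow> complex \<Rightarrow> complex) \<Rightarrow> complex \<Rightarrow> complex" where
  "theta_quotient N z = deriv (\<lambda>z. theta1 z \<tau>) 0 / N 0 \<tau> * (N z \<tau> / theta1 z \<tau>)"

lemma theta_quotient_add_1:
  "theta_quotient theta2 (z + 1) = theta_quotient theta2 z"
  "theta_quotient theta3 (z + 1) = - theta_quotient theta3 z"
  "theta_quotient theta4 (z + 1) = - theta_quotient theta4 z"
  by (simp_all add: theta_quotient_def theta1_add_1[OF \<tau>] theta2_add_1[OF \<tau>] theta3_add_1[OF \<tau>] theta4_add_1[OF \<tau>])

lemma theta_quotient_add_tau:
  "theta_quotient theta2 (z + \<tau>) = - theta_quotient theta2 z"
  "theta_quotient theta3 (z + \<tau>) = - theta_quotient theta3 z"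
  "theta_quotient theta4 (z + \<tau>) = theta_quotient theta4 z"
  by (simp_all add: theta_quotient_def theta1_add_tau[OF \<tau>] theta2_add_tau[OF \<tau>] theta3_add_tau[OF \<tau>] theta4_add_tau[OF \<tau>])

lemma theta_quotient_minus: "theta_quotient theta2 (- z) = - theta_quotient theta2 z"
  by (simp add: theta_quotient_def theta1_minus[OF \<tau>] theta2_minus[OF \<tau>])

lemma theta_quotient_analytic:
  assumes "z \<notin> lattice \<tau>"
  shows "theta_quotient theta2 analytic_on {z}" "theta_quotient theta3 analytic_on {z}"
    "theta_quotient theta4 analytic_on {z}"
  using assms theta1_eq_0_iff[of z] theta2_0 theta3_0 theta4_0 unfolding theta_quotient_def[abs_def]
  by (auto intro!: analytic_intros theta1_analytic[OF \<tau>] theta2_analytic[OF \<tau>] theta3_analytic[OF \<tau>] theta4_analytic[OF \<tau>])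

lemma theta_quotient_pole:
  obtains m2 m3 m4 where "simple_pole_form (theta_quotient theta2) m2"
    "simple_pole_form (theta_quotient theta3) m3" "simple_pole_form (theta_quotient theta4) m4"
proof -
  note D = theta1_analytic[OF \<tau>] theta1_minus[OF \<tau>] deriv_theta1_0
  obtain m2 where "simple_pole_form (theta_quotient theta2) m2"
    unfolding theta_quotient_def[abs_def]
    by (rule even_odd_quotient_pole[OF theta2_analytic[OF \<tau>] theta2_minus[OF \<tau>] theta2_0 D])
  moreover obtain m3 where "simple_pole_form (theta_quotient theta3) m3"
    unfolding theta_quotient_def[abs_def]
    by (rule even_odd_quotient_pole[OF theta3_analytic[OF \<tau>] theta3_minus[OF \<tau>] theta3_0 D])
  moreover obtain m4 where "simple_pole_form (theta_quotient theta4) m4"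
    unfolding theta_quotient_def[abs_def]
    by (rule even_odd_quotient_pole[OF theta4_analytic[OF \<tau>] theta4_minus[OF \<tau>] theta4_0 D])
  ultimately show thesis by (rule that)
qed

text \<open>The squares are doubly periodic and their double poles cancel. For the theta quotients,
  which are multiples of cs, ds and ns, these are the quadratic relations between the Jacobi
  functions.\<close>

lemma square_difference_const:
  assumes f: "simple_pole_form f m" and g: "simple_pole_form g n"
    and "\<And>z. z \<notin> lattice \<tau> \<Longrightarrow> f analytic_on {z}" "\<And>z. z \<notin> lattice \<tau> \<Longrightarrow> g analytic_on {z}"
    and "\<And>z. (f (z + 1))\<^sup>2 = (f z)\<^sup>2" "\<And>z. (f (z + \<tau>))\<^sup>2 = (f z)\<^sup>2"
    and "\<And>z. (g (z + 1))\<^sup>2 = (g z)\<^sup>2" "\<And>z. (g (z + \<tau>))\<^sup>2 = (g z)\<^sup>2"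
    and "z \<notin> lattice \<tau>"
  shows "(f z)\<^sup>2 - (g z)\<^sup>2 = 2 * (m 0 - n 0)"
proof -
  let ?h = "\<lambda>z. 2 * (m z - n z) + z\<^sup>2 * ((m z)\<^sup>2 - (n z)\<^sup>2)"
  have ev: "\<forall>\<^sub>F z in at 0. z \<noteq> (0::complex)" by (auto simp: eventually_at intro!: exI[of _ 1])
  show ?thesis
  proof (rule liouville_lattice[of "\<lambda>z. (f z)\<^sup>2 - (g z)\<^sup>2" 1 1 ?h])
    show "?h analytic_on {0}"
      using f g by (auto simp: simple_pole_form_def intro!: analytic_intros)
    have "\<forall>\<^sub>F z in at 0. f z = 1 / z + z * m z" "\<forall>\<^sub>F z in at 0. g z = 1 / z + z * n z"
      using f g by (auto simp: simple_pole_form_def)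
    with ev show "\<forall>\<^sub>F z in at 0. (f z)\<^sup>2 - (g z)\<^sup>2 = ?h z"
    proof eventually_elim
      case (elim z)
      show ?case unfolding elim(2,3) using elim(1) by (simp add: field_simps power2_eq_square)
    qed
  qed (use assms in \<open>auto intro!: analytic_intros\<close>)
qed

text \<open>The classical identity \<open>cs' = - ns ds\<close>: the sum \<open>?g\<close> has
  cancelling double poles and multiplier \<open>- 1\<close> under \<open>\<tau>\<close>, so its
  constant value equals its own negative. That value is \<open>m2 0 + m3 0 + m4 0\<close>.\<close>

lemma pole_coefficients_sum:
  assumes 2: "simple_pole_form (theta_quotient theta2) m2"
    and 3: "simple_pole_form (theta_quotient theta3) m3"
    and 4: "simple_pole_form (theta_quotient theta4) m4"
  shows "m2 0 + m3 0 + m4 0 = 0"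
proof -
  let ?g = "\<lambda>z. deriv (theta_quotient theta2) z + theta_quotient theta3 z * theta_quotient theta4 z"
  \<comment> \<open>The value 0 on the lattice replaces the unspecified \<open>deriv\<close> at the
    poles, so that the multiplier laws hold at every point.\<close>
  let ?f = "\<lambda>z. if z \<in> lattice \<tau> then 0 else ?g z"
  let ?h = "\<lambda>z. m2 z + z * deriv m2 z + m3 z + m4 z + z\<^sup>2 * (m3 z * m4 z)"
  have ev: "\<forall>\<^sub>F z in at 0. z \<noteq> (0::complex)" by (auto simp: eventually_at intro!: exI[of _ 1])
  have d: "deriv (theta_quotient theta2) (z + \<omega>) = \<epsilon> * deriv (theta_quotient theta2) z"
    if "\<And>z. theta_quotient theta2 (z + \<omega>) = \<epsilon> * theta_quotient theta2 z" "z \<notin> lattice \<tau>" for \<omega> \<epsilon> z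
  proof -
    have "deriv (theta_quotient theta2) (z + \<omega>) = deriv (\<lambda>x. theta_quotient theta2 (x + \<omega>)) z"
      by (simp add: deriv_def DERIV_shift)
    also have "\<dots> = \<epsilon> * deriv (theta_quotient theta2) z"
      unfolding that(1)
      by (rule deriv_cmult) (meson analytic_on_imp_differentiable_at singletonI theta_quotient_analytic(1) that(2))
    finally show ?thesis .
  qed
  have "?h 0 = - 1 * ?h 0"
  proof (rule liouville_lattice[of ?f 1 "- 1" ?h])
    show "?f (z + 1) = 1 * ?f z" for z
      using d[of 1 1 z] by (simp add: theta_quotient_add_1 lattice_add)
    show "?f (z + \<tau>) = - 1 * ?f z" for z
      using d[of \<tau> "- 1" z] by (simp add: theta_quotient_add_tau lattice_add)
    show "?f analytic_on {z}" if z: "z \<notin> lattice \<tau>" for z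
    proof -
      have ana: "?g analytic_on {z}"
        by (intro analytic_intros analytic_deriv theta_quotient_analytic z)
      have "\<forall>\<^sub>F w in nhds z. ?f w = ?g w"
        using eventually_nhds_not_lattice[OF z] by eventually_elim simp
      from analytic_at_cong[OF this refl] ana show ?thesis by simp
    qed
    show "?h analytic_on {0}"
      using 2 3 4 by (auto simp: simple_pole_form_def intro!: analytic_intros analytic_deriv)
    have "\<forall>\<^sub>F z in at 0. theta_quotient theta3 z = 1 / z + z * m3 z"
      "\<forall>\<^sub>F z in at 0. theta_quotient theta4 z = 1 / z + z * m4 z"
      using 3 4 by (auto simp: simple_pole_form_def)
    with ev eventually_at_0_not_lattice simple_pole_form_deriv[OF 2] show "\<forall>\<^sub>F z in at 0. ?f z = ?h z"
    proof eventually_elim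
      case (elim z)
      then show ?case unfolding elim(3-5) by (simp add: field_simps power2_eq_square)
    qed
  qed auto
  then have "2 * (m2 0 + m3 0 + m4 0) = 0" by (simp add: algebra_simps)
  then have "(2 :: complex) = 0 \<or> m2 0 + m3 0 + m4 0 = 0" by (simp only: mult_eq_0_iff)
  then show ?thesis by simp
qed

text \<open>Evaluating the constant square differences at half periods, where one numerator
  vanishes, expresses the differences of \<open>m2 0\<close>, \<open>m3 0\<close>,
  \<open>m4 0\<close> by theta constants; \<open>pole_coefficients_sum\<close> then determines
  \<open>m2 0\<close> itself.\<close>

lemma jacobi_quartic_and_pole_coefficient:
  assumes 2: "simple_pole_form (theta_quotient theta2) m2"
  shows "theta3 0 \<tau> ^ 4 = theta2 0 \<tau> ^ 4 + theta4 0 \<tau> ^ 4"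
    and "- 6 * m2 0 * (theta2 0 \<tau> * theta4 0 \<tau> / (theta3 0 \<tau> * deriv (\<lambda>z. theta1 z \<tau>) 0))\<^sup>2 =
      1 + (theta4 0 \<tau> / theta3 0 \<tau>) ^ 4"
proof -
  let ?c = "deriv (\<lambda>z. theta1 z \<tau>) 0" and ?a = "theta2 0 \<tau>" and ?b = "theta3 0 \<tau>" and ?d = "theta4 0 \<tau>"
  obtain m3 m4 where 3: "simple_pole_form (theta_quotient theta3) m3"
    and 4: "simple_pole_form (theta_quotient theta4) m4"
    by (rule theta_quotient_pole)
  note nz = theta2_0 theta3_0 theta4_0 deriv_theta1_0
  have per2: "(theta_quotient theta2 (z + 1))\<^sup>2 = (theta_quotient theta2 z)\<^sup>2"
      "(theta_quotient theta2 (z + \<tau>))\<^sup>2 = (theta_quotient theta2 z)\<^sup>2"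
    and per3: "(theta_quotient theta3 (z + 1))\<^sup>2 = (theta_quotient theta3 z)\<^sup>2"
      "(theta_quotient theta3 (z + \<tau>))\<^sup>2 = (theta_quotient theta3 z)\<^sup>2"
    and per4: "(theta_quotient theta4 (z + 1))\<^sup>2 = (theta_quotient theta4 z)\<^sup>2"
      "(theta_quotient theta4 (z + \<tau>))\<^sup>2 = (theta_quotient theta4 z)\<^sup>2" for z
    by (simp_all add: theta_quotient_add_1 theta_quotient_add_tau)
  have "- (?c * ?d / (?b * ?a))\<^sup>2 = 2 * (m2 0 - m3 0)"
    using square_difference_const[OF 2 3 theta_quotient_analytic(1,2) per2 per3 half_periods_not_lattice(1)]
    by (simp add: theta_quotient_def theta_at_half)
  moreover have "- (?c * ?b / (?d * ?a))\<^sup>2 = 2 * (m2 0 - m4 0)"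
    using square_difference_const[OF 2 4 theta_quotient_analytic(1,3) per2 per4 half_periods_not_lattice(1)]
    by (simp add: theta_quotient_def theta_at_half)
  \<comment> \<open>The evaluation point is now \<open>1/2 + \<tau> / 2\<close>, the zero of
    \<open>theta3\<close>.\<close>
  moreover have "- (?c * ?a / (?d * ?b))\<^sup>2 = 2 * (m3 0 - m4 0)"
    using square_difference_const[OF 3 4 theta_quotient_analytic(2,3) per3 per4 half_periods_not_lattice(3)]
    by (simp add: theta_quotient_def theta_at_half_sum)
  moreover note pole_coefficients_sum[OF 2 3 4]
  \<comment> \<open>The first equation adds the differences along \<open>m2\<close>,
    \<open>m3\<close>, \<open>m4\<close>. The second uses that
    \<open>(m2 0 - m3 0) + (m2 0 - m4 0) = 3 * m2 0\<close> by the vanishing sum.\<close>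
  ultimately have e: "(?c * ?b / (?d * ?a))\<^sup>2 = (?c * ?d / (?b * ?a))\<^sup>2 + (?c * ?a / (?d * ?b))\<^sup>2"
    "- 6 * m2 0 = (?c * ?d / (?b * ?a))\<^sup>2 + (?c * ?b / (?d * ?a))\<^sup>2"
    by algebra+
  from e(1) have "?b ^ 4 * ?c\<^sup>2 = (?a ^ 4 + ?d ^ 4) * ?c\<^sup>2"
    using nz by (simp add: field_simps power2_eq_square eval_nat_numeral)
  then show "?b ^ 4 = ?a ^ 4 + ?d ^ 4"
    using nz by simp
  show "- 6 * m2 0 * (?a * ?d / (?b * ?c))\<^sup>2 = 1 + (?d / ?b) ^ 4"
    unfolding e(2) using nz by (simp add: field_simps power2_eq_square eval_nat_numeral)
qed

end

section \<open>Reciprocity\<close>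

lemma lattice_add_mem:
  assumes "z \<in> lattice \<tau>" "w \<in> lattice \<tau>"
  shows "z + w \<in> lattice \<tau>"
proof -
  obtain m n where z: "z = of_int m * \<tau> + of_int n" using assms(1) by (rule latticeE)
  obtain k l where w: "w = of_int k * \<tau> + of_int l" using assms(2) by (rule latticeE)
  show ?thesis by (rule latticeI[of _ "m + k" _ "n + l"]) (simp add: z w algebra_simps)
qed

lemma lattice_mult:
  assumes "z \<in> lattice \<tau>"
  shows "of_int c * z \<in> lattice \<tau>"
proof -
  obtain m n where z: "z = of_int m * \<tau> + of_int n" using assms by (rule latticeE)
  show ?thesis by (rule latticeI[of _ "c * m" _ "c * n"]) (simp add: z algebra_simps)
qed

text \<open>By Bezout. Consequently \<open>g (a z)\<close> and \<open>g (b z)\<close> have common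
  poles only at lattice points.\<close>

lemma lattice_coprime:
  assumes "coprime a b" "of_int a * z \<in> lattice \<tau>" "of_int b * z \<in> lattice \<tau>"
  shows "z \<in> lattice \<tau>"
proof -
  obtain u v where "u * a + v * b = 1"
    using bezout_int[of a b] assms(1) by auto
  then have "of_int (u * a + v * b) * z = z" by simp
  then have "z = of_int u * (of_int a * z) + of_int v * (of_int b * z)"
    by (simp add: algebra_simps)
  then show ?thesis
    using lattice_add_mem[OF lattice_mult[OF assms(2), of u] lattice_mult[OF assms(3), of v]] by simp
qed

definition torsion_point :: "complex \<Rightarrow> int \<Rightarrow> int \<times> int \<Rightarrow> complex" where
  "torsion_point \<tau> b = (\<lambda>(\<mu>, \<nu>). (of_int \<mu> * \<tau> + of_int \<nu>) / of_int b)"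

definition torsion_index :: "int \<Rightarrow> (int \<times> int) set" where
  "torsion_index b = {0..b - 1} \<times> {0..b - 1} - {(0, 0)}"

lemma finite_torsion_index [simp]: "finite (torsion_index b)"
  by (simp add: torsion_index_def)

lemma torsion_point_mult:
  "b \<noteq> 0 \<Longrightarrow> of_int b * torsion_point \<tau> b i = of_int (fst i) * \<tau> + of_int (snd i)"
  by (simp add: torsion_point_def case_prod_unfold)

lemma Ints_abs_less_1: "(x :: real) \<in> \<int> \<Longrightarrow> \<bar>x\<bar> < 1 \<Longrightarrow> x = 0"
  using Ints_nonzero_abs_less1 by blast

text \<open>Both real coordinates of the difference have absolute value below 1, and membership in
  the lattice makes them integers.\<close>

lemma torsion_point_diff:
  assumes "Im \<tau> > 0" "b > 0" "i \<in> {0..b - 1} \<times> {0..b - 1}" "j \<in> {0..b - 1} \<times> {0..b - 1}"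
    and "torsion_point \<tau> b i - torsion_point \<tau> b j \<in> lattice \<tau>"
  shows "i = j"
proof -
  obtain \<mu> \<nu> \<mu>' \<nu>' where ij: "i = (\<mu>, \<nu>)" "j = (\<mu>', \<nu>')" by fastforce
  have eq: "torsion_point \<tau> b i - torsion_point \<tau> b j =
      of_real (of_int (\<mu> - \<mu>') / of_int b) * \<tau> + of_real (of_int (\<nu> - \<nu>') / of_int b)"
    using assms(2) by (simp add: torsion_point_def ij field_simps)
  have small: "\<bar>of_int (x - y) / of_int b\<bar> < (1 :: real)"
    if "x \<in> {0..b - 1}" "y \<in> {0..b - 1}" for x y
  proof -
    have "\<bar>x - y\<bar> < b" using that by auto
    then have "\<bar>of_int (x - y)\<bar> < (of_int b :: real)" by linarith
    then show ?thesis using assms(2) by (simp add: abs_divide)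
  qed
  have "Im \<tau> \<noteq> 0" using assms(1) by simp
  note L = lattice_Int_reals[OF this assms(5)[unfolded eq]]
  have "of_int (\<mu> - \<mu>') / of_int b = (0 :: real)" "of_int (\<nu> - \<nu>') / of_int b = (0 :: real)"
    using Ints_abs_less_1[OF L(1) small] Ints_abs_less_1[OF L(2) small] assms(3,4) by (simp_all add: ij)
  then show ?thesis using assms(2) by (simp add: ij)
qed

lemma torsion_point_not_lattice:
  assumes "Im \<tau> > 0" "b > 0" "i \<in> torsion_index b"
  shows "torsion_point \<tau> b i \<notin> lattice \<tau>"
proof
  assume "torsion_point \<tau> b i \<in> lattice \<tau>"
  then have "torsion_point \<tau> b i - torsion_point \<tau> b (0, 0) \<in> lattice \<tau>"
    by (simp add: torsion_point_def)
  with assms have "i = (0, 0)"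
    by (intro torsion_point_diff[of \<tau> b]) (auto simp: torsion_index_def)
  with assms(3) show False by (simp add: torsion_index_def)
qed

text \<open>The index is obtained by reducing the lattice coordinates of \<open>b z\<close> modulo
  \<open>b\<close>.\<close>

lemma torsion_point_exists:
  assumes "b > 0" "z \<notin> lattice \<tau>" "of_int b * z \<in> lattice \<tau>"
  obtains i where "i \<in> torsion_index b" "z - torsion_point \<tau> b i \<in> lattice \<tau>"
proof -
  obtain m n where mn: "of_int b * z = of_int m * \<tau> + of_int n"
    using assms(3) by (rule latticeE)
  let ?i = "(m mod b, n mod b)"
  have "of_int m = (of_int (m div b) * of_int b + of_int (m mod b) :: complex)" for m
    unfolding of_int_mult[symmetric] of_int_add[symmetric] by simp
  note mod = this[of m] this[of n]
  have "of_int b * torsion_point \<tau> b ?i = of_int (m mod b) * \<tau> + of_int (n mod b)"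
    using assms(1) by (simp add: torsion_point_mult)
  with mn mod have "of_int b * (z - torsion_point \<tau> b ?i) = of_int b * (of_int (m div b) * \<tau> + of_int (n div b))"
    by algebra
  then have eq: "z - torsion_point \<tau> b ?i = of_int (m div b) * \<tau> + of_int (n div b)"
    using assms(1) by simp
  then have L: "z - torsion_point \<tau> b ?i \<in> lattice \<tau>" by (rule latticeI)
  have "?i \<noteq> (0, 0)"
    using L assms(2) by (auto simp: torsion_point_def)
  then have "?i \<in> torsion_index b"
    using assms(1) by (auto simp: torsion_index_def)
  with L that show thesis by blast
qed

section \<open>Reciprocity for an odd function with multipliers 1 and -1\<close>

text \<open>Here \<open>d\<close> stands for the derivative of \<open>g\<close>. It is a separate parameter because \<open>deriv g\<close> is unspecified
  at the poles, where its multiplier laws would be unavailable.\<close>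

locale odd_quasi_elliptic =
  fixes \<tau> :: complex and g m d n :: "complex \<Rightarrow> complex"
  assumes \<tau>: "Im \<tau> > 0"
    and g_add_1: "g (z + 1) = g z"
    and g_add_tau: "g (z + \<tau>) = - g z"
    and g_minus: "g (- z) = - g z"
    and g_analytic: "z \<notin> lattice \<tau> \<Longrightarrow> g analytic_on {z}"
    and g_pole: "simple_pole_form g m"
    and d_add_1: "d (z + 1) = d z"
    and d_add_tau: "d (z + \<tau>) = - d z"
    and d_analytic: "z \<notin> lattice \<tau> \<Longrightarrow> d analytic_on {z}"
    and n_analytic: "n analytic_on {0}"
    and d_pole: "\<forall>\<^sub>F z in at 0. d z = - 1 / z\<^sup>2 + n z"
begin

lemma g_lattice: "g (z + (of_int k * \<tau> + of_int l)) = (-1) powi k * g z"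
proof -
  have "g (z + (of_int k * \<tau> + of_int l)) = g ((z + of_int l * 1) + of_int k * \<tau>)"
    by (simp add: algebra_simps)
  also have "\<dots> = (-1) powi k * g (z + of_int l * 1)"
    by (rule powi_multiplier) (simp_all add: g_add_tau)
  also have "g (z + of_int l * 1) = 1 powi l * g z"
    by (rule powi_multiplier) (simp_all add: g_add_1)
  finally show ?thesis by simp
qed

lemma g_compose_analytic:
  assumes "f analytic_on {z}" "f z \<notin> lattice \<tau>"
  shows "(\<lambda>z. g (f z)) analytic_on {z}"
proof -
  have "(g \<circ> f) analytic_on {z}"
    by (rule analytic_on_compose) (use assms g_analytic in auto)
  then show ?thesis by (simp add: o_def)
qed

lemma m_analytic: "m analytic_on {0}"
  using g_pole by (simp add: simple_pole_form_def)

lemma m_compose_analytic: "(\<lambda>z. m (c * (z - p))) analytic_on {p}"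
proof -
  have "(m \<circ> (\<lambda>z. c * (z - p))) analytic_on {p}"
    by (rule analytic_on_compose) (auto intro!: analytic_intros m_analytic)
  then show ?thesis by (simp add: o_def)
qed

lemma g_pole_at:
  assumes "c \<noteq> 0"
  shows "\<forall>\<^sub>F z in at p. g (c * (z - p)) = 1 / (c * (z - p)) + c * (z - p) * m (c * (z - p))"
proof -
  have "((\<lambda>z. c * (z - p)) \<longlongrightarrow> c * (p - p)) (at p)"
    by (intro tendsto_intros)
  then have lim: "filterlim (\<lambda>z. c * (z - p)) (at 0) (at p)"
    using assms by (auto simp: filterlim_at eventually_at intro!: exI[of _ 1])
  have "\<forall>\<^sub>F z in at 0. g z = 1 / z + z * m z"
    using g_pole by (simp add: simple_pole_form_def)
  from eventually_compose_filterlim[OF this lim] show ?thesis .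
qed

text \<open>The coefficients are the residues of \<open>g (a z) * g (b z)\<close> at the
  \<open>b\<close>-torsion points outside the lattice, for coprime positive \<open>a\<close> and
  \<open>b\<close>.\<close>

definition polar_part :: "int \<Rightarrow> int \<Rightarrow> complex \<Rightarrow> complex" where
  "polar_part a b z = (\<Sum>i\<in>torsion_index b.
     (-1) powi fst i * g (of_int a * torsion_point \<tau> b i) / of_int b * g (z - torsion_point \<tau> b i))"

definition torsion_sum :: "int \<Rightarrow> int \<Rightarrow> complex" where
  "torsion_sum a b = (\<Sum>i\<in>torsion_index b.
     (-1) powi fst i * g (of_int a * torsion_point \<tau> b i) * g (torsion_point \<tau> b i))"

text \<open>Near 0 the product behaves like \<open>1 / (a b z^2)\<close>, which the term with
  \<open>d\<close> cancels.\<close>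

definition remainder_fun :: "int \<Rightarrow> int \<Rightarrow> complex \<Rightarrow> complex" where
  "remainder_fun a b z = g (of_int a * z) * g (of_int b * z) + d z / (of_int a * of_int b)
     - polar_part a b z - polar_part b a z"

lemma remainder_fun_commute: "remainder_fun a b = remainder_fun b a"
  by (rule ext) (simp add: remainder_fun_def mult.commute)

lemma polar_part_add_1: "polar_part a b (z + 1) = polar_part a b z"
  using g_add_1[of "z - p" for p] by (simp add: polar_part_def algebra_simps)

lemma polar_part_add_tau: "polar_part a b (z + \<tau>) = - polar_part a b z"
proof -
  have "g (z + \<tau> - p) = - g (z - p)" for p
    using g_add_tau[of "z - p"] by (simp add: algebra_simps)
  then show ?thesis by (simp add: polar_part_def sum_negf)
qed

lemma polar_part_0: "polar_part a b 0 = - torsion_sum a b / of_int b"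
  by (simp add: polar_part_def torsion_sum_def g_minus sum_negf sum_divide_distrib)

lemma polar_part_analytic:
  assumes "\<And>i. i \<in> torsion_index b \<Longrightarrow> z - torsion_point \<tau> b i \<notin> lattice \<tau>"
  shows "polar_part a b analytic_on {z}"
  unfolding polar_part_def[abs_def]
  by (intro analytic_on_sum analytic_on_mult analytic_on_const g_compose_analytic)
     (auto intro!: analytic_intros simp: assms)

text \<open>At a \<open>b\<close>-torsion point only \<open>g (b z)\<close> and one summand of
  \<open>polar_part a b\<close> have poles. Their residues agree, and what remains of the singular
  part is a difference quotient of \<open>g (a z)\<close>.\<close>

lemma remainder_removable_torsion:
  assumes ab: "a > 0" "b > 0" "coprime a b" and i: "i \<in> torsion_index b"
  shows "removable (remainder_fun a b) (torsion_point \<tau> b i)"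
proof -
  define p where "p = torsion_point \<tau> b i"
  define \<rho> where "\<rho> = (-1) powi fst i * g (of_int a * p) / of_int b"
  let ?rest = "\<lambda>z. \<Sum>j\<in>torsion_index b - {i}.
     (-1) powi fst j * g (of_int a * torsion_point \<tau> b j) / of_int b * g (z - torsion_point \<tau> b j)"
  let ?s = "(-1) powi fst i :: complex"
  let ?A = "of_int a :: complex" and ?B = "of_int b :: complex"
  have p: "p \<notin> lattice \<tau>" unfolding p_def by (rule torsion_point_not_lattice[OF \<tau> ab(2) i])
  have bp: "?B * p = of_int (fst i) * \<tau> + of_int (snd i)"
    unfolding p_def using ab by (simp add: torsion_point_mult)
  then have bpL: "?B * p \<in> lattice \<tau>" by (rule latticeI)
  have ap: "?A * p \<notin> lattice \<tau>"
    using lattice_coprime[OF ab(3) _ bpL] p by blast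
  \<comment> \<open>Since \<open>b p\<close> is a lattice point, the expansion of \<open>g\<close>
    at 0 describes \<open>g (b z)\<close> near \<open>p\<close>, up to the sign
    \<open>?s\<close>.\<close>
  have gb: "g (?B * z) = ?s * g (?B * (z - p))" for z
    using g_lattice[of "?B * (z - p)" "fst i" "snd i"] unfolding bp[symmetric] right_diff_distrib by simp
  have ga: "(\<lambda>z. g (?A * z)) analytic_on {p}"
    by (rule g_compose_analytic) (auto intro!: analytic_intros ap)
  have part: "polar_part a b z = \<rho> * g (z - p) + ?rest z" for z
    unfolding polar_part_def by (subst sum.remove[OF _ i]) (simp_all add: \<rho>_def p_def)
  have rest: "?rest analytic_on {p}"
  proof (intro analytic_on_sum analytic_on_mult analytic_on_const g_compose_analytic)
    fix j assume "j \<in> torsion_index b - {i}"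
    then show "p - torsion_point \<tau> b j \<notin> lattice \<tau>"
      using torsion_point_diff[OF \<tau> ab(2), of i j] i unfolding p_def torsion_index_def by blast
  qed (auto intro!: analytic_intros)
  have other: "polar_part b a analytic_on {p}"
  proof (rule polar_part_analytic)
    fix j assume "j \<in> torsion_index a"
    show "p - torsion_point \<tau> a j \<notin> lattice \<tau>"
    proof
      assume "p - torsion_point \<tau> a j \<in> lattice \<tau>"
      then have "?A * (p - torsion_point \<tau> a j) \<in> lattice \<tau>" by (rule lattice_mult)
      moreover have "?A * torsion_point \<tau> a j \<in> lattice \<tau>"
        by (rule latticeI, rule torsion_point_mult) (use ab in auto)
      ultimately have "?A * (p - torsion_point \<tau> a j) + ?A * torsion_point \<tau> a j \<in> lattice \<tau>"
        by (rule lattice_add_mem)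
      with ap show False by (simp add: algebra_simps)
    qed
  qed
  \<comment> \<open>The first summand is the difference quotient; all the others are analytic at
    \<open>p\<close>.\<close>
  let ?f = "\<lambda>z. (?s / ?B) * ((g (?A * z) - g (?A * p)) / (z - p)) +
      (?s * g (?A * z) * ?B * (z - p) * m (?B * (z - p)) - \<rho> * ((z - p) * m (1 * (z - p))) +
       d z / (?A * ?B) - ?rest z - polar_part b a z)"
  have "removable ?f p"
    by (intro removable_add removable_mult removable_const removable_difference_quotient[OF ga] removable_analytic)
       (intro analytic_intros ga m_compose_analytic d_analytic p rest other, use ab in auto)
  moreover have "\<forall>\<^sub>F z in at p. remainder_fun a b z = ?f z"
  proof -
    have "\<forall>\<^sub>F z in at p. z \<noteq> p" by (auto simp: eventually_at intro!: exI[of _ 1])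
    moreover have "\<forall>\<^sub>F z in at p. g (?B * (z - p)) = 1 / (?B * (z - p)) + ?B * (z - p) * m (?B * (z - p))"
      using ab by (intro g_pole_at) simp
    moreover have "\<forall>\<^sub>F z in at p. g (1 * (z - p)) = 1 / (1 * (z - p)) + 1 * (z - p) * m (1 * (z - p))"
      by (intro g_pole_at) simp
    ultimately show ?thesis
    proof eventually_elim
      case (elim z)
      have g1: "g (z - p) = 1 / (z - p) + (z - p) * m (1 * (z - p))" using elim(3) by simp
      \<comment> \<open>A purely rational identity, stated for free variables so that clearing
        denominators does not touch the function values.\<close>
      have key: "G * (s * (1 / (B * w) + M)) + E - (s * G0 / B * (1 / w + M') + R) - P =
          s / B * ((G - G0) / w) + (s * G * M - s * G0 / B * M' + E - R - P)"
        if "w \<noteq> 0" "B \<noteq> 0" for s G G0 B w M M' E R P :: complex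
        using that by (simp add: field_simps)
      have nz: "z - p \<noteq> 0" "?B \<noteq> 0" using elim(1) ab by auto
      show ?case
        unfolding remainder_fun_def part gb[of z] elim(2) g1 unfolding \<rho>_def key[OF nz] by (simp only: mult.assoc)
    qed
  qed
  ultimately show ?thesis unfolding p_def by (rule removable_cong)
qed

text \<open>The remainder vanishes by Liouville, and the identity is its constant term at 0; the
  torsion sums enter through \<open>polar_part_0\<close>.\<close>

theorem reciprocity:
  assumes ab: "a > 0" "b > 0" "coprime a b" "odd (a + b)"
  shows "torsion_sum a b / of_int b + torsion_sum b a / of_int a =
    - ((of_int b / of_int a + of_int a / of_int b) * m 0 + n 0 / (of_int a * of_int b))"
proof -
  let ?A = "of_int a :: complex" and ?B = "of_int b :: complex"
  let ?R = "remainder_fun a b"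
  have nz: "?A \<noteq> 0" "?B \<noteq> 0" using ab by auto
  have gA1: "g (of_int c * (z + 1)) = g (of_int c * z)" for c z
    using g_lattice[of "of_int c * z" 0 c] by (simp add: algebra_simps)
  have gAt: "g (of_int c * (z + \<tau>)) = (-1) powi c * g (of_int c * z)" for c z
    using g_lattice[of "of_int c * z" c 0] by (simp add: algebra_simps)
  \<comment> \<open>Oddness of \<open>a + b\<close> gives the product the same multiplier
    \<open>- 1\<close> as \<open>g\<close> and \<open>d\<close>; this sign later forces the constant
    to be 0.\<close>
  have sgn: "(-1) powi a * (-1) powi b = (- 1 :: complex)"
    using ab(4) by (subst power_int_add[symmetric]) auto
  have R1: "?R (z + 1) = 1 * ?R z" for z
    by (simp add: remainder_fun_def gA1 polar_part_add_1 d_add_1)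
  have "g (?A * (z + \<tau>)) * g (?B * (z + \<tau>)) = - (g (?A * z) * g (?B * z))" for z
  proof -
    have "g (?A * (z + \<tau>)) * g (?B * (z + \<tau>)) = ((-1) powi a * (-1) powi b) * (g (?A * z) * g (?B * z))"
      unfolding gAt by (simp only: mult_ac)
    then show ?thesis unfolding sgn by simp
  qed
  then have Rt: "?R (z + \<tau>) = - 1 * ?R z" for z
    by (simp add: remainder_fun_def polar_part_add_tau d_add_tau)
  \<comment> \<open>The expansion of the remainder at 0 after cancellation of the double pole; the
    form \<open>z - 0\<close> matches \<open>g_pole_at\<close> and \<open>m_compose_analytic\<close>
    at \<open>p = 0\<close>.\<close>
  let ?h = "\<lambda>z. (?B / ?A) * m (?B * (z - 0)) + (?A / ?B) * m (?A * (z - 0)) +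
     ?A * ?B * z\<^sup>2 * (m (?A * (z - 0)) * m (?B * (z - 0))) + n z / (?A * ?B) - polar_part a b z - polar_part b a z"
  have pp: "polar_part a b analytic_on {0}" if "b > 0" for a b
    by (rule polar_part_analytic)
       (use torsion_point_not_lattice[OF \<tau> that] lattice_minus[OF \<tau>] in auto)
  have h: "?h analytic_on {0}"
    by (intro analytic_intros m_compose_analytic n_analytic pp ab) (use nz in auto)
  have hR: "\<forall>\<^sub>F z in at 0. ?R z = ?h z"
  proof -
    have "\<forall>\<^sub>F z in at 0. z \<noteq> (0::complex)" by (auto simp: eventually_at intro!: exI[of _ 1])
    with g_pole_at[OF nz(1), of 0] g_pole_at[OF nz(2), of 0] d_pole show ?thesis
    proof eventually_elim
      case (elim z)
      have key: "(1 / (?A * z) + ?A * z * M) * (1 / (?B * z) + ?B * z * M') + (- 1 / z\<^sup>2 + N) / (?A * ?B) =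
         (?B / ?A) * M' + (?A / ?B) * M + ?A * ?B * z\<^sup>2 * (M * M') + N / (?A * ?B)" for M M' N
        using nz elim(4) by (simp add: field_simps power2_eq_square)
      show ?case using key elim(1-3) by (simp add: remainder_fun_def)
    qed
  qed
  have "removable ?R z" for z
  proof -
    have inv: "removable ?R z = removable ?R w" if "z - w \<in> lattice \<tau>" for w
      by (rule lattice_invariant[where P = "removable ?R", OF _ _ that])
         (use removable_multiplier[of ?R 1, OF R1] removable_multiplier[of ?R \<tau>, OF Rt] in auto)
    \<comment> \<open>The possible poles are lattice points, \<open>b\<close>-torsion and
      \<open>a\<close>-torsion points; the third case follows from the second by symmetry in
      \<open>a\<close> and \<open>b\<close>.\<close>
    consider "z \<in> lattice \<tau>" | "z \<notin> lattice \<tau>" "?B * z \<in> lattice \<tau>" | "z \<notin> lattice \<tau>" "?A * z \<in> lattice \<tau>"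
      | "z \<notin> lattice \<tau>" "?B * z \<notin> lattice \<tau>" "?A * z \<notin> lattice \<tau>" by blast
    then show ?thesis
    proof cases
      case 1
      then show ?thesis using inv[of 0] removableI[OF h hR] by simp
    next
      case 2
      obtain i where "i \<in> torsion_index b" "z - torsion_point \<tau> b i \<in> lattice \<tau>"
        using torsion_point_exists[OF ab(2) 2] .
      then show ?thesis using inv remainder_removable_torsion[OF ab(1-3)] by simp
    next
      case 3
      obtain i where i: "i \<in> torsion_index a" "z - torsion_point \<tau> a i \<in> lattice \<tau>"
        using torsion_point_exists[OF ab(1) 3] .
      have "coprime b a" using ab(3) by (simp add: coprime_commute)
      from remainder_removable_torsion[OF ab(2,1) this i(1)] inv[OF i(2)]
      show ?thesis by (simp add: remainder_fun_commute[of b a])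
    next
      case 4
      have tp: "z - torsion_point \<tau> c i \<notin> lattice \<tau>" if "of_int c * z \<notin> lattice \<tau>" "c > 0" for c i
      proof
        assume "z - torsion_point \<tau> c i \<in> lattice \<tau>"
        then have "of_int c * (z - torsion_point \<tau> c i) \<in> lattice \<tau>" by (rule lattice_mult)
        moreover have "of_int c * torsion_point \<tau> c i \<in> lattice \<tau>"
          by (rule latticeI, rule torsion_point_mult) (use that in auto)
        ultimately have "of_int c * (z - torsion_point \<tau> c i) + of_int c * torsion_point \<tau> c i \<in> lattice \<tau>"
          by (rule lattice_add_mem)
        with that show False by (simp add: algebra_simps)
      qed
      have "?R analytic_on {z}" unfolding remainder_fun_def[abs_def]
        by (intro analytic_intros g_compose_analytic polar_part_analytic d_analytic tp) (use 4 nz ab in auto)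
      then show ?thesis by (rule removable_analytic)
    qed
  qed
  then obtain C where C: "\<And>z. \<forall>\<^sub>F w in at z. ?R w = C" "C = - 1 * C"
    using liouville_quasiperiodic[OF \<tau> R1 _ Rt] by (metis norm_minus_cancel norm_one)
  from C(2) have "C = 0" by simp
  from hR C(1)[of 0] have "\<forall>\<^sub>F z in at 0. ?h z = C" by eventually_elim simp
  with h have "?h 0 = C" by (rule analytic_eventually_const)
  with \<open>C = 0\<close> show ?thesis by (simp add: polar_part_0 algebra_simps eq_neg_iff_add_eq_0)
qed

end

section \<open>The elliptic Dedekind sum\<close>

context
  fixes \<tau> :: complex
  assumes \<tau>: "Im \<tau> > 0"
begin

text \<open>Jacobi's quartic identity trades \<open>theta2\<close> for \<open>theta4\<close>, which
  matches the expression found for the pole coefficient.\<close>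

lemma elliptic_lambda_eq: "elliptic_lambda \<tau> = 1 - (theta4 0 \<tau> / theta3 0 \<tau>) ^ 4"
proof -
  obtain m3 where "simple_pole_form (theta_quotient \<tau> theta2) m3"
    by (rule theta_quotient_pole[OF \<tau>])
  from jacobi_quartic_and_pole_coefficient(1)[OF \<tau> this]
  have eq: "theta2 0 \<tau> ^ 4 = theta3 0 \<tau> ^ 4 - theta4 0 \<tau> ^ 4" by simp
  have "elliptic_lambda \<tau> = theta2 0 \<tau> ^ 4 / theta3 0 \<tau> ^ 4"
    by (simp add: elliptic_lambda_def elliptic_k_def power_divide)
  then show ?thesis using theta3_0[OF \<tau>] by (simp add: eq diff_divide_distrib power_divide)
qed

text \<open>Minus the product of the other two quotients plays the role of the derivative of
  \<open>theta_quotient \<tau> theta2\<close>. The vanishing sum of pole coefficients yields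
  \<open>n 0 = m 0\<close>, as for a true derivative of \<open>1 / z + z * m z\<close>.\<close>

lemma theta_quotient_odd_quasi_elliptic:
  obtains m n where "odd_quasi_elliptic \<tau> (theta_quotient \<tau> theta2) m
      (\<lambda>z. - (theta_quotient \<tau> theta3 z * theta_quotient \<tau> theta4 z)) n"
    "n 0 = m 0"
    "- 6 * m 0 * (theta2 0 \<tau> * theta4 0 \<tau> / (theta3 0 \<tau> * deriv (\<lambda>z. theta1 z \<tau>) 0))\<^sup>2 =
      2 - elliptic_lambda \<tau>"
proof -
  obtain m2 m3 m4 where m: "simple_pole_form (theta_quotient \<tau> theta2) m2"
    "simple_pole_form (theta_quotient \<tau> theta3) m3" "simple_pole_form (theta_quotient \<tau> theta4) m4"
    by (rule theta_quotient_pole[OF \<tau>])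
  let ?n = "\<lambda>z. - (m3 z + m4 z + z\<^sup>2 * (m3 z * m4 z))"
  have E: "odd_quasi_elliptic \<tau> (theta_quotient \<tau> theta2) m2
      (\<lambda>z. - (theta_quotient \<tau> theta3 z * theta_quotient \<tau> theta4 z)) ?n"
  proof
    show "?n analytic_on {0}"
      using m(2,3) by (auto simp: simple_pole_form_def intro!: analytic_intros)
    have "\<forall>\<^sub>F z in at 0. theta_quotient \<tau> theta3 z = 1 / z + z * m3 z"
      "\<forall>\<^sub>F z in at 0. theta_quotient \<tau> theta4 z = 1 / z + z * m4 z"
      using m(2,3) by (auto simp: simple_pole_form_def)
    moreover have "\<forall>\<^sub>F z in at 0. z \<noteq> (0::complex)" by (auto simp: eventually_at intro!: exI[of _ 1])
    ultimately show "\<forall>\<^sub>F z in at 0. - (theta_quotient \<tau> theta3 z * theta_quotient \<tau> theta4 z) = - 1 / z\<^sup>2 + ?n z"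
    proof eventually_elim
      case (elim z)
      show ?case unfolding elim(1,2) using elim(3) by (simp add: field_simps power2_eq_square)
    qed
  qed (use \<tau> m(1) in \<open>auto simp: theta_quotient_add_1[OF \<tau>] theta_quotient_add_tau[OF \<tau>]
        theta_quotient_minus[OF \<tau>] intro!: analytic_intros theta_quotient_analytic[OF \<tau>]\<close>)
  have "m2 0 = - (m3 0 + m4 0)"
    using pole_coefficients_sum[OF \<tau> m] by (simp only: eq_neg_iff_add_eq_0 add.assoc)
  then have n: "?n 0 = m2 0" by simp
  have "1 + (theta4 0 \<tau> / theta3 0 \<tau>) ^ 4 = 2 - elliptic_lambda \<tau>"
    by (simp add: elliptic_lambda_eq)
  with jacobi_quartic_and_pole_coefficient(2)[OF \<tau> m(1)] show thesis
    by (intro that[OF E n]) simp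
qed

lemma jacobi_cs_theta_quotient:
  "jacobi_cs (2 * elliptic_K \<tau> * z) \<tau> =
     theta2 0 \<tau> * theta4 0 \<tau> / (theta3 0 \<tau> * deriv (\<lambda>z. theta1 z \<tau>) 0) * theta_quotient \<tau> theta2 z"
  using theta2_0[OF \<tau>] theta3_0[OF \<tau>] deriv_theta1_0[OF \<tau>]
  by (simp add: jacobi_cs_def theta_quotient_def[OF \<tau>] elliptic_K_def)

lemma elliptic_dedekind_sum_torsion:
  "elliptic_dedekind_sum \<tau> a b =
     (theta2 0 \<tau> * theta4 0 \<tau> / (theta3 0 \<tau> * deriv (\<lambda>z. theta1 z \<tau>) 0))\<^sup>2 / (4 * of_int b) *
     (\<Sum>i\<in>torsion_index b. (-1) powi fst i * theta_quotient \<tau> theta2 (of_int a * torsion_point \<tau> b i) *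
        theta_quotient \<tau> theta2 (torsion_point \<tau> b i))"
proof -
  define c where "c = theta2 0 \<tau> * theta4 0 \<tau> / (theta3 0 \<tau> * deriv (\<lambda>z. theta1 z \<tau>) 0)"
  have "elliptic_dedekind_sum \<tau> a b = 1 / (4 * of_int b) * (\<Sum>i\<in>torsion_index b. (-1) powi fst i *
      (c * theta_quotient \<tau> theta2 (of_int a * torsion_point \<tau> b i)) * (c * theta_quotient \<tau> theta2 (torsion_point \<tau> b i)))"
    unfolding elliptic_dedekind_sum_def torsion_index_def[symmetric] mult.assoc[of "2 * elliptic_K \<tau>"]
      jacobi_cs_theta_quotient c_def[symmetric]
    by (simp add: torsion_point_def case_prod_unfold)
  also have "\<dots> = c\<^sup>2 / (4 * of_int b) * (\<Sum>i\<in>torsion_index b. (-1) powi fst i *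
      theta_quotient \<tau> theta2 (of_int a * torsion_point \<tau> b i) * theta_quotient \<tau> theta2 (torsion_point \<tau> b i))"
    unfolding sum_distrib_left by (rule sum.cong[OF refl]) (simp add: power2_eq_square mult_ac)
  finally show ?thesis unfolding c_def .
qed

lemma elliptic_dedekind_sum_reciprocity:
  assumes "a > 0" "b > 0" "coprime a b" "odd (a + b)"
  shows "elliptic_dedekind_sum \<tau> a b + elliptic_dedekind_sum \<tau> b a =
    of_int (a\<^sup>2 + b\<^sup>2 + 1) / (4 * of_int a * of_int b) * (1/3 - 1/6 * elliptic_lambda \<tau>)"
proof -
  obtain m n where E: "odd_quasi_elliptic \<tau> (theta_quotient \<tau> theta2) m
      (\<lambda>z. - (theta_quotient \<tau> theta3 z * theta_quotient \<tau> theta4 z)) n" and n: "n 0 = m 0"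
    and m: "- 6 * m 0 * (theta2 0 \<tau> * theta4 0 \<tau> / (theta3 0 \<tau> * deriv (\<lambda>z. theta1 z \<tau>) 0))\<^sup>2 =
      2 - elliptic_lambda \<tau>"
    by (rule theta_quotient_odd_quasi_elliptic)
  interpret odd_quasi_elliptic \<tau> "theta_quotient \<tau> theta2" m
      "\<lambda>z. - (theta_quotient \<tau> theta3 z * theta_quotient \<tau> theta4 z)" n by (rule E)
  define c where "c = (theta2 0 \<tau> * theta4 0 \<tau> / (theta3 0 \<tau> * deriv (\<lambda>z. theta1 z \<tau>) 0))\<^sup>2"
  define A B where "A = (of_int a :: complex)" and "B = (of_int b :: complex)"
  have nz: "A \<noteq> 0" "B \<noteq> 0" using assms by (auto simp: A_def B_def)
  have "elliptic_dedekind_sum \<tau> a b + elliptic_dedekind_sum \<tau> b a =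
      c / 4 * (torsion_sum a b / B + torsion_sum b a / A)"
    unfolding elliptic_dedekind_sum_torsion torsion_sum_def[symmetric] c_def[symmetric] A_def B_def
    by (simp add: algebra_simps)
  also have "\<dots> = c / 4 * (- ((B / A + A / B) * m 0 + m 0 / (A * B)))"
    unfolding A_def B_def reciprocity[OF assms] n ..
  \<comment> \<open>From \<open>B/A + A/B + 1/(A B) = (A^2 + B^2 + 1) / (A B)\<close>; the factor 6
    is split off to match the known value of \<open>- 6 * m 0 * c\<close>.\<close>
  also have "\<dots> = (A\<^sup>2 + B\<^sup>2 + 1) / (4 * A * B) * ((- 6 * m 0 * c) / 6)"
    using nz by (simp add: field_simps power2_eq_square)
  also have "- 6 * m 0 * c = 2 - elliptic_lambda \<tau>" using m by (simp add: c_def)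
  finally show ?thesis by (simp add: A_def B_def diff_divide_distrib)
qed

lemma elliptic_dedekind_sum_minus: "elliptic_dedekind_sum \<tau> (- a) b = - elliptic_dedekind_sum \<tau> a b"
  by (simp add: elliptic_dedekind_sum_torsion theta_quotient_minus[OF \<tau>] sum_negf)

text \<open>Adding \<open>2 b k\<close> to \<open>a\<close> translates the argument by an even
  multiple of \<open>\<mu> \<tau> + \<nu>\<close>; evenness removes the sign that \<open>g\<close>
  acquires under \<open>\<tau>\<close>.\<close>

lemma elliptic_dedekind_sum_periodic:
  assumes "b > 0"
  shows "elliptic_dedekind_sum \<tau> (a + 2 * b * k) b = elliptic_dedekind_sum \<tau> a b"
proof -
  obtain m n where "odd_quasi_elliptic \<tau> (theta_quotient \<tau> theta2) m
      (\<lambda>z. - (theta_quotient \<tau> theta3 z * theta_quotient \<tau> theta4 z)) n"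
    by (rule theta_quotient_odd_quasi_elliptic)
  then interpret odd_quasi_elliptic \<tau> "theta_quotient \<tau> theta2" m
      "\<lambda>z. - (theta_quotient \<tau> theta3 z * theta_quotient \<tau> theta4 z)" n .
  have "theta_quotient \<tau> theta2 (of_int (a + 2 * b * k) * torsion_point \<tau> b i) =
     theta_quotient \<tau> theta2 (of_int a * torsion_point \<tau> b i)" for i
  proof -
    have "of_int (a + 2 * b * k) * torsion_point \<tau> b i =
        of_int a * torsion_point \<tau> b i + 2 * of_int k * (of_int b * torsion_point \<tau> b i)"
      by (simp add: algebra_simps)
    also have "\<dots> = of_int a * torsion_point \<tau> b i +
        (of_int (2 * k * fst i) * \<tau> + of_int (2 * k * snd i))"
      using assms by (simp add: torsion_point_mult algebra_simps)
    finally show ?thesis by (simp only: g_lattice) simp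
  qed
  then show ?thesis unfolding elliptic_dedekind_sum_torsion by simp
qed

lemma elliptic_dedekind_sum_1: "elliptic_dedekind_sum \<tau> a 1 = 0"
  by (simp add: elliptic_dedekind_sum_def)

end

section \<open>The rational number Q\<close>

text \<open>At \<open>\<tau> = \<i>\<close> the nome is real, hence so are the theta constants, and
  \<open>elliptic_lambda\<close> is 1 minus a real fourth power. This makes the factor
  \<open>1/3 - 1/6 * elliptic_lambda\<close> nonzero there.\<close>

lemma elliptic_lambda_neq_2: "elliptic_lambda \<i> \<noteq> 2"
proof -
  have i: "Im \<i> > 0" by simp
  have real: "theta3 0 \<i> \<in> \<real>" "theta4 0 \<i> \<in> \<real>"
  proof -
    have q: "qpow \<i> r = of_real (exp (- 2 * pi * r))" for r
      by (simp add: qpow_def exp_of_real[symmetric] mult_ac)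
    have S1: "summable (\<lambda>n. theta_coeff \<i> (Suc n) * x ^ Suc n)" for x
      using theta_half_summable[OF i, of x] by (subst summable_Suc_iff)
    have r: "(\<Sum>n. f n) \<in> \<real>" if "summable f" "\<And>n. f n \<in> \<real>" for f :: "nat \<Rightarrow> complex"
    proof -
      have "(\<lambda>n. \<Sum>k<n. f k) \<longlonglongrightarrow> suminf f" using that(1) by (rule summable_LIMSEQ)
      moreover have "\<forall>\<^sub>F n in sequentially. (\<Sum>k<n. f k) \<in> \<real>"
        using that(2) by (intro always_eventually allI sum_in_Reals) auto
      ultimately show ?thesis
        by (rule Lim_in_closed_set[OF closed_complex_Reals, rotated 2]) auto
    qed
    have "(\<Sum>n. theta_coeff \<i> (Suc n) * x ^ Suc n) \<in> \<real>" if "x \<in> \<real>" for x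
      by (rule r[OF S1]) (auto simp: theta_coeff_def q intro!: Reals_mult Reals_power that)
    \<comment> \<open>\<open>x = 1\<close> gives the series of \<open>theta3\<close>, and
      \<open>x = - 1\<close> the alternating one of \<open>theta4\<close>.\<close>
    from this[of 1] this[of "- 1"] show "theta3 0 \<i> \<in> \<real>" "theta4 0 \<i> \<in> \<real>"
      by (auto simp: theta3_def theta4_def theta_coeff_def mult.commute intro!: Reals_add Reals_mult)
  qed
  note lam = elliptic_lambda_eq[OF i]
  obtain r :: real where r: "theta4 0 \<i> / theta3 0 \<i> = of_real r"
    using real by (meson Reals_cases Reals_divide)
  have "Re (elliptic_lambda \<i>) = 1 - r ^ 4"
    unfolding lam r by (simp flip: of_real_power)
  moreover have "r ^ 4 \<ge> 0" by (rule zero_le_even_power) simp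
  ultimately have "Re (elliptic_lambda \<i>) < 2" by linarith
  then show ?thesis by auto
qed

text \<open>\<open>N\<close> is \<open>4bQ(a; b)\<close>; the congruences are those reproduced by a step of the Euclidean algorithm.\<close>

lemma elliptic_dedekind_numerator:
  fixes a b :: int
  assumes "b > 0" "coprime a b" "odd (a + b)"
  shows "\<exists>N::int. (\<forall>\<tau>. Im \<tau> > 0 \<longrightarrow> elliptic_dedekind_sum \<tau> a b =
        of_int N / (4 * of_int b) * (1/3 - 1/6 * elliptic_lambda \<tau>))
     \<and> b dvd a * N - (a\<^sup>2 + b\<^sup>2 + 1) \<and> (even b \<longrightarrow> 4 * b dvd a * N - (a\<^sup>2 + b\<^sup>2 + 1))
     \<and> (odd b \<longrightarrow> 4 dvd N)"
  using assms
proof (induction "nat b" arbitrary: a b rule: less_induct)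
  case less
  note b = less.prems(1)
  show ?case
  proof (cases "b = 1")
    case True
    then show ?thesis by (intro exI[of _ 0]) (simp add: elliptic_dedekind_sum_1)
  next
    case False
    with b have b2: "b > 1" by simp
    \<comment> \<open>\<open>k\<close> makes \<open>a'\<close> the residue of least absolute value
      modulo \<open>2 b\<close>, so that its absolute value is at most \<open>b\<close>.\<close>
    define k where "k = (if a mod (2 * b) \<le> b then a div (2 * b) else a div (2 * b) + 1)"
    define a' where "a' = a - 2 * b * k"
    define c where "c = \<bar>a'\<bar>"
    have "a = 2 * b * (a div (2 * b)) + a mod (2 * b)" "0 \<le> a mod (2 * b)" "a mod (2 * b) < 2 * b"
      using b by (auto simp: mult_div_mod_eq)
    then have "c \<le> b"
      unfolding c_def a'_def k_def by (auto simp: algebra_simps)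
    have a: "a = a' + 2 * b * k" by (simp add: a'_def)
    have cop: "coprime a' b"
    proof -
      have "gcd b ((2 * k) * b + a') = gcd b a'" by (rule gcd_add_mult)
      moreover have "(2 * k) * b + a' = a" by (simp add: a)
      ultimately show ?thesis using less.prems(2) by (metis coprime_iff_gcd_eq_1 gcd.commute)
    qed
    then have copc: "coprime b c" by (simp add: c_def coprime_commute)
    \<comment> \<open>Coprimality and \<open>b > 1\<close> exclude the boundary values, which makes
      the descent from \<open>b\<close> to \<open>c\<close> strict.\<close>
    have "c \<noteq> b" using copc b2 by auto
    moreover have "c \<noteq> 0" using copc b2 by auto
    ultimately have c: "0 < c" "c < b" using \<open>c \<le> b\<close> by (auto simp: c_def)
    have oddc: "odd (b + c)" using less.prems(3) by (auto simp: c_def a)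
    from less.hyps[of c b] c copc oddc obtain N' where N': "\<And>\<tau>. Im \<tau> > 0 \<Longrightarrow>
        elliptic_dedekind_sum \<tau> b c = of_int N' / (4 * of_int c) * (1/3 - 1/6 * elliptic_lambda \<tau>)"
      and d1: "c dvd b * N' - (b\<^sup>2 + c\<^sup>2 + 1)"
      and d2: "even c \<Longrightarrow> 4 * c dvd b * N' - (b\<^sup>2 + c\<^sup>2 + 1)" and d3: "odd c \<Longrightarrow> 4 dvd N'"
      by auto
    \<comment> \<open>The first congruence for \<open>N'\<close> makes the numerator supplied by
      reciprocity, \<open>(c^2 + b^2 + 1 - b * N') / c\<close>, an integer.\<close>
    obtain M where M: "b * N' - (b\<^sup>2 + c\<^sup>2 + 1) = c * M" using d1 by (auto elim: dvdE)
    define N where "N = - M"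
    have N: "c * N = c\<^sup>2 + b\<^sup>2 + 1 - b * N'" using M by (simp add: N_def)
    have sc: "elliptic_dedekind_sum \<tau> c b = of_int N / (4 * of_int b) * (1/3 - 1/6 * elliptic_lambda \<tau>)"
      if \<tau>: "Im \<tau> > 0" for \<tau>
    proof -
      define G where "G = 1/3 - 1/6 * elliptic_lambda \<tau>"
      have nz: "(of_int b :: complex) \<noteq> 0" "(of_int c :: complex) \<noteq> 0" using b c by auto
      have "elliptic_dedekind_sum \<tau> c b + elliptic_dedekind_sum \<tau> b c =
          of_int (c\<^sup>2 + b\<^sup>2 + 1) / (4 * of_int c * of_int b) * G"
        unfolding G_def by (rule elliptic_dedekind_sum_reciprocity[OF \<tau>])
          (use b c copc oddc in \<open>auto simp: coprime_commute add.commute\<close>)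
      also have "c\<^sup>2 + b\<^sup>2 + 1 = c * N + b * N'" using N by simp
      also have "of_int (c * N + b * N') / (4 * of_int c * of_int b) * G =
          of_int N / (4 * of_int b) * G + of_int N' / (4 * of_int c) * G"
        using nz by (simp add: field_simps)
      finally show ?thesis unfolding N'[OF \<tau>] G_def by simp
    qed
    have e1: "b dvd c * N - (c\<^sup>2 + b\<^sup>2 + 1)" by (simp add: N)
    \<comment> \<open>By \<open>N\<close>, the expression equals \<open>- b * N'\<close>. Since
      \<open>b\<close> and \<open>c\<close> have opposite parity, the conditions modulo 4 for even
      and odd denominators exchange their roles in \<open>e2\<close> and \<open>e3\<close>.\<close>
    have e2: "4 * b dvd c * N - (c\<^sup>2 + b\<^sup>2 + 1)" if "even b"
    proof -
      have "4 dvd N'" using d3 that oddc by auto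
      then show ?thesis by (simp add: N mult.commute[of 4 b])
    qed
    have e3: "4 dvd N" if "odd b"
    proof -
      have "4 * c dvd c * M" using d2 that oddc unfolding M by auto
      then show ?thesis using c by (simp add: N_def mult.commute[of 4 c])
    qed
    define N0 where "N0 = sgn a' * N"
    have a'N0: "a' * N0 = c * N" by (simp add: N0_def c_def abs_sgn mult_ac)
    have a'2: "a'\<^sup>2 = c\<^sup>2" by (simp add: c_def)
    have "a' \<noteq> 0" using c by (auto simp: c_def)
    have "elliptic_dedekind_sum \<tau> a b = of_int N0 / (4 * of_int b) * (1/3 - 1/6 * elliptic_lambda \<tau>)"
      if \<tau>: "Im \<tau> > 0" for \<tau>
    proof -
      have "elliptic_dedekind_sum \<tau> a b = elliptic_dedekind_sum \<tau> a' b"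
        unfolding a by (rule elliptic_dedekind_sum_periodic[OF \<tau> b])
      also have "\<dots> = of_int (sgn a') * elliptic_dedekind_sum \<tau> c b"
        using \<open>a' \<noteq> 0\<close> elliptic_dedekind_sum_minus[OF \<tau>, of a' b] by (auto simp: c_def sgn_if)
      finally show ?thesis unfolding sc[OF \<tau>] N0_def by simp
    qed
    \<comment> \<open>Undoing the reduction of \<open>a\<close> modulo \<open>2 b\<close> changes
      the expression by \<open>2 b k N0\<close> and by a multiple of \<open>4 b\<close>.\<close>
    moreover have eq: "a * N0 - (a\<^sup>2 + b\<^sup>2 + 1) =
        c * N - (c\<^sup>2 + b\<^sup>2 + 1) + (b * (2 * k * N0) - 4 * b * (k * a' + b * k\<^sup>2))"
      unfolding a a'N0[symmetric] a'2[symmetric] by (simp add: algebra_simps power2_eq_square)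
    have "b dvd a * N0 - (a\<^sup>2 + b\<^sup>2 + 1)"
      unfolding eq by (intro dvd_add e1 dvd_diff) auto
    moreover have "4 * b dvd a * N0 - (a\<^sup>2 + b\<^sup>2 + 1)" if "even b"
    proof -
      \<comment> \<open>For even \<open>b\<close>, \<open>e2\<close> and oddness of \<open>c\<close>
        show that \<open>N\<close> is even, which turns \<open>2 b k N0\<close> into a multiple of
        \<open>4 b\<close>.\<close>
      have "even (4 * b)" by simp
      then have "even (c * N - (c\<^sup>2 + b\<^sup>2 + 1))" using e2[OF that] by (rule dvd_trans)
      moreover have "odd c" using oddc that by simp
      ultimately have "even N" using that by auto
      then have "4 * b dvd b * (2 * k * N0)" by (auto simp: N0_def elim!: evenE)
      then show ?thesis
        unfolding eq by (intro dvd_add e2[OF that] dvd_diff) auto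
    qed
    moreover have "4 dvd N0" if "odd b" using e3[OF that] by (simp add: N0_def)
    ultimately show ?thesis by blast
  qed
qed

text \<open>Uniqueness in the \<open>THE\<close> is tested at \<open>\<tau> = \<i>\<close>, where
  the factor is nonzero.\<close>

lemma Q_eqI:
  assumes "\<And>\<tau>. Im \<tau> > 0 \<Longrightarrow> elliptic_dedekind_sum \<tau> a b = of_rat r * (1/3 - 1/6 * elliptic_lambda \<tau>)"
  shows "Q a b = r"
  unfolding Q_def
proof (rule the_equality)
  fix r' assume "\<forall>\<tau>. Im \<tau> > 0 \<longrightarrow> elliptic_dedekind_sum \<tau> a b = of_rat r' * (1/3 - 1/6 * elliptic_lambda \<tau>)"
  with assms[of \<i>] have "of_rat r' * (1/3 - 1/6 * elliptic_lambda \<i>) = of_rat r * (1/3 - 1/6 * elliptic_lambda \<i>)"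
    by simp
  moreover have "1/3 - 1/6 * elliptic_lambda \<i> \<noteq> 0" using elliptic_lambda_neq_2 by auto
  ultimately show "r' = r" by simp
qed (use assms in blast)

theorem theorem8:
  fixes a b :: int
  assumes "(a, b) \<in> Uo"
  shows "(\<exists>M::int. of_int b * Q a b = of_int a * (1 - 3 * of_int b) / 2 + of_int M)
    \<and> (odd a \<and> even b \<longrightarrow> (\<exists>m::int. of_int b * Q a b = 1/2 + of_int m))
    \<and> (even a \<and> odd b \<longrightarrow> of_int b * Q a b \<in> \<int>)"
proof -
  have ab: "b > 0" "coprime a b" "odd (a + b)"
    using assms by (auto simp: Uo_def coprime_iff_gcd_eq_1)
  then obtain N where N: "\<And>\<tau>. Im \<tau> > 0 \<Longrightarrow> elliptic_dedekind_sum \<tau> a b =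
        of_int N / (4 * of_int b) * (1/3 - 1/6 * elliptic_lambda \<tau>)"
    and even: "even b \<Longrightarrow> 4 * b dvd a * N - (a\<^sup>2 + b\<^sup>2 + 1)" and odd: "odd b \<Longrightarrow> 4 dvd N"
    using elliptic_dedekind_numerator by blast
  have "Q a b = of_int N / (4 * of_int b)"
    by (rule Q_eqI) (simp add: N of_rat_divide of_rat_mult)
  then have bQ: "of_int b * Q a b = of_int N / 4" using ab by simp
  \<comment> \<open>With \<open>a\<close> odd and \<open>b\<close> even,
    \<open>2 * a - (a^2 + b^2 + 1) = - (a - 1)^2 - b^2\<close> is divisible by 4, and the odd factor
    \<open>a\<close> can be cancelled.\<close>
  have mod4: "4 dvd N - 2" if b: "even b"
  proof -
    have a: "odd a" using ab(3) b by simp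
    obtain x where x: "a = 2 * x + 1" using a by (rule oddE)
    obtain y where y: "b = 2 * y" using b by (rule evenE)
    have "4 dvd a * N - (a\<^sup>2 + b\<^sup>2 + 1)" using even[OF b] by (rule dvd_mult_left)
    moreover have "a * N - (a\<^sup>2 + b\<^sup>2 + 1) = a * (N - 2) + 4 * (- x\<^sup>2 - y\<^sup>2)"
      by (simp add: x y power2_eq_square algebra_simps)
    ultimately have "4 dvd a * (N - 2)"
      by (metis dvd_add_left_iff dvd_triv_left)
    moreover have "coprime 4 a" using coprime_power_left_iff[of 2 2 a] a by simp
    ultimately show ?thesis by (simp add: coprime_dvd_mult_right_iff)
  qed
  show ?thesis
  proof (cases "even b")
    case True
    with ab have "odd a" by simp
    then obtain x where x: "a = 2 * x + 1" by (rule oddE)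
    obtain y where y: "b = 2 * y" using True by (rule evenE)
    obtain z where z: "N - 2 = 4 * z" using mod4[OF True] by (rule dvdE)
    then have half: "of_int b * Q a b = 1/2 + of_int z"
      unfolding bQ by (simp add: algebra_simps eq_diff_eq)
    \<comment> \<open>The witness comes from
      \<open>a (1 - 3 b) / 2 = x + 1/2 - 3 y a\<close>.\<close>
    moreover have "1/2 + of_int z = of_int a * (1 - 3 * of_int b) / 2 + (of_int (z - x + 3 * y * a) :: rat)"
      by (simp add: x y field_simps)
    ultimately show ?thesis using True by metis
  next
    case False
    with ab have "even a" by simp
    then obtain x where x: "a = 2 * x" by (rule evenE)
    obtain z where z: "N = 4 * z" using odd[OF False] by (rule dvdE)
    then have int: "of_int b * Q a b = of_int z" by (simp add: bQ)
    moreover have "of_int z = of_int a * (1 - 3 * of_int b) / 2 + (of_int (z - x * (1 - 3 * b)) :: rat)"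
      by (simp add: x field_simps)
    ultimately show ?thesis using False by (metis Ints_of_int)
  qed
qed

end
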